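(* For $i=1,2$ let $G_i$ be an étale groupoid whose unit space is compact and totally disconnected. If $G_1$ and $G_2$ are Kakutani equivalent, then $G_1$ is homologically similar to $G_2$. In particular $H_n(G_1,A)\cong H_n(G_2,A)$ for every $n$ and every topological abelian group $A$, and there is an isomorphism $\pi:H_0(G_1)\to H_0(G_2)$ with $\pi(H_0(G_1)^+)=H_0(G_2)^+$.
   Context: An étale groupoid is a locally compact Hausdorff groupoid whose range map $r$ is a local homeomorphism; $s$ is the source map. $Y\subset G^{(0)}$ is $G$-full if for every $x\in G^{(0)}$ there is $g$ with $r(g)=x$, $s(g)\in Y$; $G|Y=r^{-1}(Y)\cap s^{-1}(Y)$. $G_1,G_2$ are Kakutani equivalent if there are $G_i$-full clopen $Y_i\subset G_i^{(0)}$ with $G_1|Y_1\cong G_2|Y_2$ as topological groupoids. A homomorphism is a continuous map preserving composable pairs and products; it is étale if it is a local homeomorphism. Homomorphisms $\rho,\sigma:G\to H$ are similar if there is a continuous $\theta:G^{(0)}\to H$ with $\theta(r(g))\rho(g)=\sigma(g)\theta(s(g))$ for all $g$. $G,H$ are homologically similar if there are étale homomorphisms $\rho:G\to H$, $\sigma:H\to G$ with $\sigma\circ\rho$ similar to $\mathrm{id}_G$ and $\rho\circ\sigma$ similar to $\mathrm{id}_H$. Homology with coefficients $A$: $G^{(n)}$ composable $n$-strings, $d_0,\dots,d_n$ the face maps (delete first entry, multiply adjacent entries, delete last entry), $\pi_*(f)(y)=\sum_{\pi(x)=y}f(x)$ on $C_c(\cdot,A)$, $\delta_1=s_*-r_*$,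 $\delta_n=\sum_{i=0}^n(-1)^id_{i*}$, $H_n(G,A)=\ker\delta_n/\operatorname{Im}\delta_{n+1}$; $H_0(G)=H_0(G,\mathbb{Z})$ and $H_0(G)^+=\{[f]: f\ge0\}$. *)

theory Defs
  imports "HOL-Analysis.Analysis" "HOL-Algebra.Coset"
begin

lemma open_int_singleton: "open {x::int}"
proof -
  have "{x} = {x - 1 <..< x + 1}" by auto
  then show ?thesis by simp
qed
instance int :: topological_ab_group_add
  apply intro_classes
  apply (simp add: nhds_discrete_open open_int_singleton
        filterlim_principal eventually_principal)
  done

text \<open>A groupoid is given by its set of arrows, source, range, (partial) multiplication,
  inverse, and a topology on the arrows.  Units are arrows (the unit space is a subset of G).
  The product gmul g h is meaningful when gsrc g = grng h.\<close>

record 'a groupoid =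
  garr :: "'a set"
  gsrc :: "'a \<Rightarrow> 'a"
  grng :: "'a \<Rightarrow> 'a"
  gmul :: "'a \<Rightarrow> 'a \<Rightarrow> 'a"
  ginv :: "'a \<Rightarrow> 'a"
  gtop :: "'a topology"

definition composable :: "'a groupoid \<Rightarrow> 'a \<Rightarrow> 'a \<Rightarrow> bool" where
  "composable G g h \<longleftrightarrow> g \<in> garr G \<and> h \<in> garr G \<and> gsrc G g = grng G h"

definition units :: "'a groupoid \<Rightarrow> 'a set" where
  "units G = {x \<in> garr G. gsrc G x = x}"

definition groupoid_axioms :: "'a groupoid \<Rightarrow> bool" where
  "groupoid_axioms G \<longleftrightarrow>
     (\<forall>g \<in> garr G. gsrc G g \<in> garr G \<and> grng G g \<in> garr G \<and>
        gsrc G (gsrc G g) = gsrc G g \<and> grng G (gsrc G g) = gsrc G g \<and>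
        gsrc G (grng G g) = grng G g \<and> grng G (grng G g) = grng G g \<and>
        gmul G (grng G g) g = g \<and> gmul G g (gsrc G g) = g \<and>
        ginv G g \<in> garr G \<and> gsrc G (ginv G g) = grng G g \<and> grng G (ginv G g) = gsrc G g \<and>
        gmul G g (ginv G g) = grng G g \<and> gmul G (ginv G g) g = gsrc G g) \<and>
     (\<forall>g h. composable G g h \<longrightarrow> gmul G g h \<in> garr G \<and>
        gsrc G (gmul G g h) = gsrc G h \<and> grng G (gmul G g h) = grng G g) \<and>
     (\<forall>g h k. composable G g h \<and> composable G h k \<longrightarrow>
        gmul G (gmul G g h) k = gmul G g (gmul G h k))"

definition composable_pairs :: "'a groupoid \<Rightarrow> ('a \<times> 'a) set" where
  "composable_pairs G = {(g, h). composable G g h}"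

definition topological_groupoid :: "'a groupoid \<Rightarrow> bool" where
  "topological_groupoid G \<longleftrightarrow> groupoid_axioms G \<and> topspace (gtop G) = garr G \<and>
     continuous_map (subtopology (prod_topology (gtop G) (gtop G)) (composable_pairs G)) (gtop G)
        (\<lambda>(g, h). gmul G g h) \<and>
     continuous_map (gtop G) (gtop G) (ginv G)"

definition local_homeomorphism :: "'a topology \<Rightarrow> 'b topology \<Rightarrow> ('a \<Rightarrow> 'b) \<Rightarrow> bool" where
  "local_homeomorphism X Y f \<longleftrightarrow>
     (\<forall>x \<in> topspace X. \<exists>U. openin X U \<and> x \<in> U \<and> openin Y (f ` U) \<and>
        homeomorphic_map (subtopology X U) (subtopology Y (f ` U)) f)"

definition unit_top :: "'a groupoid \<Rightarrow> 'a topology" where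
  "unit_top G = subtopology (gtop G) (units G)"

definition etale_groupoid :: "'a groupoid \<Rightarrow> bool" where
  "etale_groupoid G \<longleftrightarrow> topological_groupoid G \<and>
     locally_compact_space (gtop G) \<and> Hausdorff_space (gtop G) \<and>
     local_homeomorphism (gtop G) (unit_top G) (grng G)"

definition totally_disconnected_space :: "'a topology \<Rightarrow> bool" where
  "totally_disconnected_space X \<longleftrightarrow> (\<forall>S. connectedin X S \<longrightarrow> (\<exists>a. S \<subseteq> {a}))"

definition full_set :: "'a groupoid \<Rightarrow> 'a set \<Rightarrow> bool" where
  "full_set G Y \<longleftrightarrow> (\<forall>x \<in> units G. \<exists>g \<in> garr G. grng G g = x \<and> gsrc G g \<in> Y)"

definition reduction :: "'a groupoid \<Rightarrow> 'a set \<Rightarrow> 'a groupoid" where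
  "reduction G Y = G\<lparr> garr := {g \<in> garr G. grng G g \<in> Y \<and> gsrc G g \<in> Y},
                      gtop := subtopology (gtop G) {g \<in> garr G. grng G g \<in> Y \<and> gsrc G g \<in> Y} \<rparr>"

definition groupoid_hom :: "'a groupoid \<Rightarrow> 'b groupoid \<Rightarrow> ('a \<Rightarrow> 'b) \<Rightarrow> bool" where
  "groupoid_hom G H f \<longleftrightarrow> continuous_map (gtop G) (gtop H) f \<and>
     (\<forall>g h. composable G g h \<longrightarrow>
        composable H (f g) (f h) \<and> f (gmul G g h) = gmul H (f g) (f h))"

definition groupoid_iso :: "'a groupoid \<Rightarrow> 'b groupoid \<Rightarrow> ('a \<Rightarrow> 'b) \<Rightarrow> bool" where
  "groupoid_iso G H f \<longleftrightarrow> groupoid_hom G H f \<and>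
     (\<exists>f'. groupoid_hom H G f' \<and> (\<forall>g \<in> garr G. f' (f g) = g) \<and> (\<forall>h \<in> garr H. f (f' h) = h))"

definition kakutani_equivalent :: "'a groupoid \<Rightarrow> 'b groupoid \<Rightarrow> bool" where
  "kakutani_equivalent G1 G2 \<longleftrightarrow>
     (\<exists>Y1 Y2 f. Y1 \<subseteq> units G1 \<and> Y2 \<subseteq> units G2 \<and>
        closedin (unit_top G1) Y1 \<and> openin (unit_top G1) Y1 \<and>
        closedin (unit_top G2) Y2 \<and> openin (unit_top G2) Y2 \<and>
        full_set G1 Y1 \<and> full_set G2 Y2 \<and>
        groupoid_iso (reduction G1 Y1) (reduction G2 Y2) f)"

definition etale_hom :: "'a groupoid \<Rightarrow> 'b groupoid \<Rightarrow> ('a \<Rightarrow> 'b) \<Rightarrow> bool" where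
  "etale_hom G H f \<longleftrightarrow> groupoid_hom G H f \<and> local_homeomorphism (gtop G) (gtop H) f"

definition similar_homs :: "'a groupoid \<Rightarrow> 'b groupoid \<Rightarrow> ('a \<Rightarrow> 'b) \<Rightarrow> ('a \<Rightarrow> 'b) \<Rightarrow> bool" where
  "similar_homs G H \<rho> \<sigma> \<longleftrightarrow>
     (\<exists>\<theta>. continuous_map (unit_top G) (gtop H) \<theta> \<and>
        (\<forall>g \<in> garr G. composable H (\<theta> (grng G g)) (\<rho> g) \<and>
                       composable H (\<sigma> g) (\<theta> (gsrc G g)) \<and>
                       gmul H (\<theta> (grng G g)) (\<rho> g) = gmul H (\<sigma> g) (\<theta> (gsrc G g))))"

definition homologically_similar :: "'a groupoid \<Rightarrow> 'b groupoid \<Rightarrow> bool" where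
  "homologically_similar G H \<longleftrightarrow>
     (\<exists>\<rho> \<sigma>. etale_hom G H \<rho> \<and> etale_hom H G \<sigma> \<and>
        similar_homs G G (\<sigma> \<circ> \<rho>) id \<and> similar_homs H H (\<rho> \<circ> \<sigma>) id)"

text \<open>Composable n-strings (g_0, ..., g_(n-1)) (0-indexed) are functions on {..<n},
  undefined elsewhere.  Degree 0 uses strings of length 1 consisting of a unit, i.e.
  an isomorphic copy of the unit space.\<close>

definition single :: "'a \<Rightarrow> nat \<Rightarrow> 'a" where
  "single x = (\<lambda>i. if i = 0 then x else undefined)"

definition strings :: "'a groupoid \<Rightarrow> nat \<Rightarrow> (nat \<Rightarrow> 'a) set" where
  "strings G n = (if n = 0 then single ` units G
     else {f \<in> PiE {..<n} (\<lambda>_. garr G). \<forall>j. Suc j < n \<longrightarrow> gsrc G (f j) = grng G (f (Suc j))})"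

definition strings_top :: "'a groupoid \<Rightarrow> nat \<Rightarrow> (nat \<Rightarrow> 'a) topology" where
  "strings_top G n = subtopology (product_topology (\<lambda>_. gtop G) {..<max n 1}) (strings G n)"

definition face :: "'a groupoid \<Rightarrow> nat \<Rightarrow> nat \<Rightarrow> (nat \<Rightarrow> 'a) \<Rightarrow> (nat \<Rightarrow> 'a)" where
  "face G n i f =
     (if n = 1 then (if i = 0 then single (gsrc G (f 0)) else single (grng G (f 0)))
      else if i = 0 then (\<lambda>j. if j < n - 1 then f (Suc j) else undefined)
      else if i = n then (\<lambda>j. if j < n - 1 then f j else undefined)
      else (\<lambda>j. if j < i - 1 then f j
                else if j = i - 1 then gmul G (f (i - 1)) (f i)
                else if j < n - 1 then f (Suc j) else undefined))"

definition Cc :: "'x topology \<Rightarrow> ('x \<Rightarrow> 'c::topological_ab_group_add) set" where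
  "Cc X = {f. continuous_map X euclidean f \<and> (\<forall>x. x \<notin> topspace X \<longrightarrow> f x = 0) \<and>
              compactin X (X closure_of {x \<in> topspace X. f x \<noteq> 0})}"

definition pushforward :: "'x topology \<Rightarrow> 'y topology \<Rightarrow> ('x \<Rightarrow> 'y) \<Rightarrow>
     ('x \<Rightarrow> 'c::topological_ab_group_add) \<Rightarrow> ('y \<Rightarrow> 'c)" where
  "pushforward X Y p f = (\<lambda>y. if y \<in> topspace Y
       then (\<Sum>x \<in> {x \<in> topspace X. p x = y \<and> f x \<noteq> 0}. f x) else 0)"

definition chains :: "'a groupoid \<Rightarrow> nat \<Rightarrow> ((nat \<Rightarrow> 'a) \<Rightarrow> 'c::topological_ab_group_add) set" where
  "chains G n = Cc (strings_top G n)"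

definition boundary :: "'a groupoid \<Rightarrow> nat \<Rightarrow> ((nat \<Rightarrow> 'a) \<Rightarrow> 'c::topological_ab_group_add)
     \<Rightarrow> ((nat \<Rightarrow> 'a) \<Rightarrow> 'c)" where
  "boundary G n f = (\<lambda>y. \<Sum>i \<in> {0..n}.
      (if even i
         then pushforward (strings_top G n) (strings_top G (n - 1)) (face G n i) f y
         else - pushforward (strings_top G n) (strings_top G (n - 1)) (face G n i) f y))"

definition cycles :: "'a groupoid \<Rightarrow> nat \<Rightarrow> ((nat \<Rightarrow> 'a) \<Rightarrow> 'c::topological_ab_group_add) set" where
  "cycles G n = (if n = 0 then chains G 0 else {f \<in> chains G n. boundary G n f = (\<lambda>_. 0)})"

definition boundaries :: "'a groupoid \<Rightarrow> nat \<Rightarrow> ((nat \<Rightarrow> 'a) \<Rightarrow> 'c::topological_ab_group_add) set" where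
  "boundaries G n = boundary G (Suc n) ` chains G (Suc n)"

definition cycle_group :: "'a groupoid \<Rightarrow> nat \<Rightarrow> ((nat \<Rightarrow> 'a) \<Rightarrow> 'c::topological_ab_group_add) monoid" where
  "cycle_group G n = \<lparr> carrier = cycles G n, monoid.mult = (\<lambda>f g x. f x + g x), one = (\<lambda>_. 0) \<rparr>"

definition homology :: "'a groupoid \<Rightarrow> nat \<Rightarrow> ((nat \<Rightarrow> 'a) \<Rightarrow> 'c::topological_ab_group_add) set monoid" where
  "homology G n = cycle_group G n Mod boundaries G n"

definition H0 :: "'a groupoid \<Rightarrow> ((nat \<Rightarrow> 'a) \<Rightarrow> int) set monoid" where
  "H0 G = homology G 0"

definition H0_pos :: "'a groupoid \<Rightarrow> ((nat \<Rightarrow> 'a) \<Rightarrow> int) set set" where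
  "H0_pos G = {r_coset (cycle_group G 0) (boundaries G 0) f | f. f \<in> cycles G 0 \<and> (\<forall>x. f x \<ge> 0)}"

end

theory Submission
  imports Defs
begin

text \<open>
  If \<open>Y\<close> is a full open set of units, total disconnectedness and compactness of the unit space allow
  local inverses of the range map to be glued along a finite clopen partition to a continuous \<open>\<theta>\<close>
  with \<open>r (\<theta> x) = x\<close> and \<open>s (\<theta> x) \<in> Y\<close>.  Then \<open>g \<mapsto> \<theta> (r g)\<inverse> g \<theta> (s g)\<close> is an etale
  homomorphism onto the reduction to \<open>Y\<close>, which \<open>\<theta>\<close> makes similar to the identity; combining this for
  both groupoids with the isomorphism of the reductions gives homological similarity.

  An etale homomorphism induces a chain map by pushing forward along local homeomorphisms, and a
  similarity induces a prism chain homotopy.  Hence homologically similar groupoids have isomorphic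
  homology; in degree zero both chain maps preserve nonnegative functions.
\<close>

subsection \<open>Local homeomorphisms\<close>

text \<open>The operators of the homology theory sum over fibres, and such sums behave well along
  local homeomorphisms. The recurring burden is to show that every map of string spaces in sight
  (faces, induced maps, prisms) is one. It is lightened by the fact that a string space is itself
  etale over the groupoid: inside a small box a string is determined by its first vertex. Local
  homeomorphisms, treated as continuous, open, locally injective maps, satisfy a cancellation law,
  and with it each case comes down to continuity and a look at the first vertex. Read categorically,
  \<open>\<theta>\<close> chooses for each unit \<open>x\<close> an arrow into \<open>x\<close>
  starting in \<open>Y\<close>. Fullness of \<open>Y\<close> says that the reduction is equivalent
  to \<open>G\<close>; the chosen arrows form the natural transformation, and conjugation by them is
  a quasi-inverse of the inclusion. The topological problem is a continuous choice: local inverses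
  of the range map disagree on overlaps of their domains, and disjoint clopen domains remove the
  overlaps.\<close>

lemma local_homeomorphism_iff:
  "local_homeomorphism X Y f \<longleftrightarrow> continuous_map X Y f \<and> open_map X Y f \<and>
     (\<forall>x \<in> topspace X. \<exists>U. openin X U \<and> x \<in> U \<and> inj_on f U)"
  (is "?L \<longleftrightarrow> ?R")
proof
  assume L: ?L
  have loc: "\<exists>U. openin X U \<and> x \<in> U \<and> openin Y (f ` U) \<and> continuous_map (subtopology X U) Y f \<and>
      open_map (subtopology X U) (subtopology Y (f ` U)) f \<and> inj_on f U" if x: "x \<in> topspace X" for x
  proof -
    obtain U where U: "openin X U" "x \<in> U" "openin Y (f ` U)"
        "homeomorphic_map (subtopology X U) (subtopology Y (f ` U)) f"
      using bspec[OF L[unfolded local_homeomorphism_def] x] by (elim exE conjE)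
    moreover have "topspace (subtopology X U) = U"
      using U(1) openin_subset by (metis topspace_subtopology_subset)
    ultimately show ?thesis
      unfolding homeomorphic_eq_everything_map continuous_map_in_subtopology by auto
  qed
  then obtain U where U: "\<And>x. x \<in> topspace X \<Longrightarrow> openin X (U x) \<and> x \<in> U x \<and> openin Y (f ` U x) \<and>
      continuous_map (subtopology X (U x)) Y f \<and>
      open_map (subtopology X (U x)) (subtopology Y (f ` U x)) f \<and> inj_on f (U x)"
    by metis
  have "continuous_map X Y f"
    by (rule pasting_lemma[where I = "topspace X" and T = U and f = "\<lambda>_. f"]) (use U in auto)
  moreover have "open_map X Y f"
    unfolding open_map_def
  proof (intro allI impI)
    fix W assume W: "openin X W"
    have "openin Y (f ` (W \<inter> U x))" if x: "x \<in> W" for x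
    proof -
      have xX: "x \<in> topspace X" using x W openin_subset by blast
      have "openin (subtopology X (U x)) (W \<inter> U x)"
        using W by (auto simp: openin_subtopology)
      then have "openin (subtopology Y (f ` U x)) (f ` (W \<inter> U x))"
        using U[OF xX] unfolding open_map_def by blast
      then show ?thesis
        using U[OF xX] openin_trans_full by blast
    qed
    then have "openin Y (\<Union>x\<in>W. f ` (W \<inter> U x))" by blast
    moreover have "(\<Union>x\<in>W. f ` (W \<inter> U x)) = f ` W"
      using U openin_subset[OF W] by blast
    ultimately show "openin Y (f ` W)" by simp
  qed
  ultimately show ?R using U by blast
next
  assume R: ?R
  show ?L
    unfolding local_homeomorphism_def
  proof
    fix x assume "x \<in> topspace X"
    then obtain U where U: "openin X U" "x \<in> U" "inj_on f U" using R by blast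
    have t: "topspace (subtopology X U) = U" "f ` U \<subseteq> topspace Y"
      using U(1) R openin_subset by (metis topspace_subtopology_subset)
        (use U(1) R openin_subset in \<open>fastforce simp: continuous_map_def\<close>)
    have "homeomorphic_map (subtopology X U) (subtopology Y (f ` U)) f"
    proof (rule bijective_open_imp_homeomorphic_map)
      show "continuous_map (subtopology X U) (subtopology Y (f ` U)) f"
        using R t by (auto simp: continuous_map_in_subtopology intro: continuous_map_from_subtopology)
      show "open_map (subtopology X U) (subtopology Y (f ` U)) f"
        using R U t by (auto simp: open_map_def openin_subtopology)
          (metis Int_absorb2 image_mono inf_le2 openin_Int)
      show "f ` topspace (subtopology X U) = topspace (subtopology Y (f ` U))"
        using t by auto
      show "inj_on f (topspace (subtopology X U))" using t U by simp
    qed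
    moreover have "openin Y (f ` U)" using R U(1) by (simp add: open_map_def)
    ultimately show "\<exists>U. openin X U \<and> x \<in> U \<and> openin Y (f ` U) \<and>
        homeomorphic_map (subtopology X U) (subtopology Y (f ` U)) f"
      using U by blast
  qed
qed

lemma local_homeomorphism_continuous: "local_homeomorphism X Y f \<Longrightarrow> continuous_map X Y f"
  and local_homeomorphism_open_map: "local_homeomorphism X Y f \<Longrightarrow> open_map X Y f"
  and local_homeomorphism_locally_injective: "local_homeomorphism X Y f \<Longrightarrow> x \<in> topspace X \<Longrightarrow>
        \<exists>U. openin X U \<and> x \<in> U \<and> inj_on f U"
  by (simp_all add: local_homeomorphism_iff)

lemma local_homeomorphism_compose:
  assumes f: "local_homeomorphism X Y f" and g: "local_homeomorphism Y Z g"
  shows "local_homeomorphism X Z (g \<circ> f)"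
  unfolding local_homeomorphism_iff
proof (intro conjI ballI)
  show "continuous_map X Z (g \<circ> f)" "open_map X Z (g \<circ> f)"
    using f g by (auto simp: local_homeomorphism_iff intro: continuous_map_compose open_map_compose)
  fix x assume x: "x \<in> topspace X"
  have fc: "continuous_map X Y f" using f by (rule local_homeomorphism_continuous)
  obtain U where U: "openin X U" "x \<in> U" "inj_on f U"
    using local_homeomorphism_locally_injective[OF f x] by blast
  have "f x \<in> topspace Y" using fc x by (auto simp: continuous_map_def)
  then obtain V where V: "openin Y V" "f x \<in> V" "inj_on g V"
    using local_homeomorphism_locally_injective[OF g] by blast
  let ?W = "U \<inter> {x \<in> topspace X. f x \<in> V}"
  have "openin X ?W"
    using U V fc by (blast intro: openin_continuous_map_preimage)
  moreover have "inj_on (g \<circ> f) ?W"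
    using U V by (auto simp: inj_on_def)
  ultimately show "\<exists>U. openin X U \<and> x \<in> U \<and> inj_on (g \<circ> f) U"
    using x U V by blast
qed

text \<open>Local injectivity is inherited from \<open>g \<circ> f\<close>. For openness, shrink to
  the preimage of an open \<open>V\<close> on which \<open>g\<close> is injective: there the image
  under \<open>f\<close> is the part of \<open>V\<close> that \<open>g\<close> maps into an open
  set. Most etaleness proofs below rest on this lemma.\<close>

lemma local_homeomorphism_cancel:
  assumes f: "continuous_map X Y f" and g: "local_homeomorphism Y Z g"
    and gf: "local_homeomorphism X Z (g \<circ> f)"
  shows "local_homeomorphism X Y f"
  unfolding local_homeomorphism_iff
proof (intro conjI ballI f)
  fix x assume x: "x \<in> topspace X"
  obtain U where "openin X U" "x \<in> U" "inj_on (g \<circ> f) U"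
    using local_homeomorphism_locally_injective[OF gf x] by blast
  then show "\<exists>U. openin X U \<and> x \<in> U \<and> inj_on f U"
    using inj_on_imageI2 by blast
next
  show "open_map X Y f"
    unfolding open_map_def
  proof (intro allI impI)
    fix W assume W: "openin X W"
    show "openin Y (f ` W)"
    proof (subst openin_subopen, intro ballI)
      fix y assume "y \<in> f ` W"
      then obtain x where x: "x \<in> W" "y = f x" by blast
      then have "f x \<in> topspace Y" using f W openin_subset by (fastforce simp: continuous_map_def)
      then obtain V where V: "openin Y V" "f x \<in> V" "inj_on g V"
        using local_homeomorphism_locally_injective[OF g] by blast
      let ?W = "W \<inter> {x \<in> topspace X. f x \<in> V}"
      have oW: "openin X ?W"
        using W V f by (blast intro: openin_continuous_map_preimage)
      then have "openin Z ((g \<circ> f) ` ?W)"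
        using local_homeomorphism_open_map[OF gf] by (simp add: open_map_def)
      then have "openin Y (V \<inter> {y \<in> topspace Y. g y \<in> (g \<circ> f) ` ?W})"
        using V(1) local_homeomorphism_continuous[OF g] by (blast intro: openin_continuous_map_preimage)
      moreover have "V \<inter> {y \<in> topspace Y. g y \<in> (g \<circ> f) ` ?W} = f ` ?W"
      proof -
        have "f ` ?W \<subseteq> topspace Y" using f by (auto simp: continuous_map_def)
        then show ?thesis using V(3) by (auto simp: inj_on_def image_iff)
      qed
      ultimately have "openin Y (f ` ?W)" by simp
      moreover have "y \<in> f ` ?W" using x V W openin_subset by blast
      ultimately show "\<exists>T. openin Y T \<and> y \<in> T \<and> T \<subseteq> f ` W" by blast
    qed
  qed
qed

lemma local_homeomorphism_cong:
  assumes "local_homeomorphism X Y f" "\<And>x. x \<in> topspace X \<Longrightarrow> f x = g x"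
  shows "local_homeomorphism X Y g"
proof -
  have "continuous_map X Y g" using assms continuous_map_eq local_homeomorphism_continuous by blast
  moreover have "open_map X Y g"
    using assms by (metis open_map_eq local_homeomorphism_open_map)
  moreover have "\<exists>U. openin X U \<and> x \<in> U \<and> inj_on g U" if x: "x \<in> topspace X" for x
  proof -
    obtain U where U: "openin X U" "x \<in> U" "inj_on f U"
      using local_homeomorphism_locally_injective[OF assms(1) x] by blast
    then have "inj_on g U" using assms(2) openin_subset[OF U(1)] inj_on_cong by (metis subsetD)
    then show ?thesis using U by blast
  qed
  ultimately show ?thesis by (simp add: local_homeomorphism_iff)
qed

lemma local_homeomorphism_inclusion:
  assumes "openin X U"
  shows "local_homeomorphism (subtopology X U) X (\<lambda>x. x)"
proof -
  have "U = topspace X \<inter> U" "openin X U" using assms openin_subset by blast+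
  then show ?thesis
    using open_map_from_subtopology[OF open_map_id assms]
    by (auto simp: local_homeomorphism_iff open_map_def id_def openin_open_subtopology intro!: exI[of _ U])
qed

lemma local_homeomorphism_into_open:
  assumes "local_homeomorphism X (subtopology Y U) f" "openin Y U"
  shows "local_homeomorphism X Y f"
  using local_homeomorphism_compose[OF assms(1) local_homeomorphism_inclusion[OF assms(2)]]
  by (simp add: o_def)

lemma local_homeomorphism_into_subtopology:
  assumes f: "local_homeomorphism X Y f" and S: "\<And>x. x \<in> topspace X \<Longrightarrow> f x \<in> S"
  shows "local_homeomorphism X (subtopology Y S) f"
  unfolding local_homeomorphism_iff
proof (intro conjI ballI)
  show "continuous_map X (subtopology Y S) f"
    using S local_homeomorphism_continuous[OF f] by (auto simp: continuous_map_in_subtopology)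
  show "open_map X (subtopology Y S) f"
    unfolding open_map_def
  proof (intro allI impI)
    fix U assume U: "openin X U"
    have "openin Y (f ` U)" using U local_homeomorphism_open_map[OF f] by (simp add: open_map_def)
    moreover have "f ` U \<subseteq> S" using S openin_subset[OF U] by blast
    ultimately show "openin (subtopology Y S) (f ` U)" by (metis Int_absorb2 openin_subtopology_Int)
  qed
qed (rule local_homeomorphism_locally_injective[OF f])

lemma homeomorphic_map_imp_local_homeomorphism:
  "homeomorphic_map X Y f \<Longrightarrow> local_homeomorphism X Y f"
  unfolding local_homeomorphism_iff homeomorphic_eq_everything_map by blast

text \<open>The preimage of \<open>U\<close> under the local inverse is the \<open>p\<close>-image
  of \<open>U \<inter> W\<close>, and \<open>p\<close> is open. These branches serve both as sheets
  of a pushforward and as local pieces of \<open>\<theta>\<close>.\<close>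

lemma local_homeomorphism_section:
  assumes p: "local_homeomorphism X Y p" and W: "openin X W" and inj: "inj_on p W"
  shows "continuous_map (subtopology Y (p ` W)) X (inv_into W p)"
  unfolding continuous_map_alt
proof (intro conjI allI impI)
  have po: "\<And>U. openin X U \<Longrightarrow> openin Y (p ` U)"
    using local_homeomorphism_open_map[OF p] by (simp add: open_map_def)
  have top: "topspace (subtopology Y (p ` W)) = p ` W"
    using openin_subset[OF po[OF W]] by (rule topspace_subtopology_subset)
  show "inv_into W p \<in> topspace (subtopology Y (p ` W)) \<rightarrow> topspace X"
    unfolding top using openin_subset[OF W] inj by auto
  fix U assume U: "openin X U"
  have "inv_into W p -` U \<inter> topspace (subtopology Y (p ` W)) = p ` (U \<inter> W)"
    unfolding top using inj by auto
  moreover have "openin (subtopology Y (p ` W)) (p ` (U \<inter> W))"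
    using po[OF openin_Int[OF U W]] po[OF W] by (simp add: openin_open_subtopology image_mono)
  ultimately show "openin (subtopology Y (p ` W)) (inv_into W p -` U \<inter> topspace (subtopology Y (p ` W)))"
    by simp
qed

subsection \<open>Compactly supported functions and pushforwards\<close>

lemma Cc_D:
  assumes "f \<in> Cc X"
  shows "continuous_map X euclidean f" "x \<notin> topspace X \<Longrightarrow> f x = 0"
    "compactin X (X closure_of {x \<in> topspace X. f x \<noteq> 0})"
  using assms by (auto simp: Cc_def)

text \<open>In a Hausdorff space the compact \<open>K\<close> is closed, so it contains the closure
  that occurs in \<open>Cc\<close>. With \<open>Cc_support\<close> as converse, supports are handled
  through compact sets containing them.\<close>

lemma Cc_I:
  assumes "Hausdorff_space X" "continuous_map X euclidean f" "\<And>x. x \<notin> topspace X \<Longrightarrow> f x = 0"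
    "compactin X K" "\<And>x. x \<in> topspace X \<Longrightarrow> f x \<noteq> 0 \<Longrightarrow> x \<in> K"
  shows "f \<in> Cc X"
proof -
  have "closedin X K" using assms compactin_imp_closedin by blast
  then have "X closure_of {x \<in> topspace X. f x \<noteq> 0} \<subseteq> K"
    using assms(5) by (intro closure_of_minimal) auto
  then show ?thesis
    using assms closed_compactin[of X K] by (auto simp: Cc_def)
qed

lemma Cc_support:
  assumes "f \<in> Cc X"
  obtains K where "compactin X K" "\<And>x. f x \<noteq> 0 \<Longrightarrow> x \<in> K"
proof (rule that)
  show "compactin X (X closure_of {x \<in> topspace X. f x \<noteq> 0})" using assms by (rule Cc_D)
  show "x \<in> X closure_of {x \<in> topspace X. f x \<noteq> 0}" if "f x \<noteq> 0" for x
    using that Cc_D(2)[OF assms, of x] closure_of_subset[of "{x \<in> topspace X. f x \<noteq> 0}" X] by blast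
qed

lemma Cc_zero: "(\<lambda>_. 0) \<in> Cc X"
  by (simp add: Cc_def)

lemma Cc_add:
  assumes X: "Hausdorff_space X" and "f \<in> Cc X" "g \<in> Cc X"
  shows "(\<lambda>x. f x + g x) \<in> Cc X"
proof -
  obtain K L where K: "compactin X K" "\<And>x. f x \<noteq> 0 \<Longrightarrow> x \<in> K"
      and L: "compactin X L" "\<And>x. g x \<noteq> 0 \<Longrightarrow> x \<in> L"
    using Cc_support assms by metis
  show ?thesis
  proof (rule Cc_I[OF X])
    show "continuous_map X euclidean (\<lambda>x. f x + g x)"
      using Cc_D(1)[OF assms(2)] Cc_D(1)[OF assms(3)]
      by (auto simp: continuous_map_atin intro!: tendsto_add)
    show "compactin X (K \<union> L)" using K L compactin_Un by blast
    show "x \<in> K \<union> L" if "f x + g x \<noteq> 0" for x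
      using that K(2)[of x] L(2)[of x] by (cases "f x = 0") auto
  qed (use Cc_D(2)[OF assms(2)] Cc_D(2)[OF assms(3)] in auto)
qed

lemma Cc_minus:
  assumes "f \<in> Cc X"
  shows "(\<lambda>x. - f x) \<in> Cc X"
proof -
  have "continuous_map X euclidean (\<lambda>x. - f x)"
    using Cc_D(1)[OF assms] by (auto simp: continuous_map_atin intro!: tendsto_minus)
  then show ?thesis using assms by (auto simp: Cc_def)
qed

lemma Cc_sum:
  assumes "Hausdorff_space X" "\<And>i. i \<in> I \<Longrightarrow> f i \<in> Cc X"
  shows "(\<lambda>x. \<Sum>i\<in>I. f i x) \<in> Cc X"
  using assms(2)
  by (induction I rule: infinite_finite_induct) (auto simp: Cc_zero intro!: Cc_add assms(1))

text \<open>The fibre inside \<open>K\<close> is compact, since points of \<open>Y\<close> are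
  closed. Finitely many open sets on which \<open>p\<close> is injective cover it, and each contains
  at most one of its points.\<close>

lemma finite_fibre_compact:
  assumes p: "local_homeomorphism X Y p" and Y: "t1_space Y" and K: "compactin X K"
  shows "finite {x \<in> K. p x = y}"
proof (cases "y \<in> topspace Y")
  case True
  have KX: "K \<subseteq> topspace X" using K compactin_subset_topspace by blast
  have cl: "closedin Y {y}" using Y True by (simp add: closedin_t1_singleton)
  have "closedin X {x \<in> topspace X. p x \<in> {y}}"
    using closedin_continuous_map_preimage[OF local_homeomorphism_continuous[OF p] cl] .
  then have "compactin X ({x \<in> topspace X. p x \<in> {y}} \<inter> K)"
    using K closed_Int_compactin by blast
  moreover have "{x \<in> topspace X. p x \<in> {y}} \<inter> K = {x \<in> K. p x = y}" using KX by blast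
  ultimately have C: "compactin X {x \<in> K. p x = y}" by simp
  obtain U where U: "\<And>x. x \<in> topspace X \<Longrightarrow> openin X (U x) \<and> x \<in> U x \<and> inj_on p (U x)"
    using local_homeomorphism_locally_injective[OF p] by metis
  have "\<exists>F. finite F \<and> F \<subseteq> U ` {x \<in> K. p x = y} \<and> {x \<in> K. p x = y} \<subseteq> \<Union>F"
    by (rule compactinD[OF C]) (use U KX in blast)+
  then obtain F where F: "finite F" "F \<subseteq> U ` {x \<in> K. p x = y}" "{x \<in> K. p x = y} \<subseteq> \<Union>F" by blast
  have "finite ({x \<in> K. p x = y} \<inter> V)" if "V \<in> F" for V
  proof -
    have "inj_on p V" using that F(2) U KX by blast
    then have "inj_on p ({x \<in> K. p x = y} \<inter> V)" by (rule inj_on_subset) blast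
    moreover have "p ` ({x \<in> K. p x = y} \<inter> V) \<subseteq> {y}" by blast
    ultimately show ?thesis using inj_on_finite by blast
  qed
  then have "finite (\<Union>V\<in>F. {x \<in> K. p x = y} \<inter> V)" using F(1) by blast
  moreover have "(\<Union>V\<in>F. {x \<in> K. p x = y} \<inter> V) = {x \<in> K. p x = y}" using F(3) by blast
  ultimately show ?thesis by simp
next
  case False
  have "{x \<in> K. p x = y} = {}"
    using False local_homeomorphism_continuous[OF p] compactin_subset_topspace[OF K]
    by (auto simp: continuous_map_def)
  then show ?thesis by (metis finite.emptyI)
qed

lemma finite_fibre_Cc:
  assumes "local_homeomorphism X Y p" "t1_space Y" "f \<in> Cc X"
  shows "finite {x \<in> topspace X. p x = y \<and> f x \<noteq> 0}"
proof -
  obtain K where K: "compactin X K" "\<And>x. f x \<noteq> 0 \<Longrightarrow> x \<in> K" using Cc_support[OF assms(3)] by blast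
  show ?thesis
    by (rule finite_subset[OF _ finite_fibre_compact[OF assms(1,2) K(1), of y]]) (use K(2) in auto)
qed

text \<open>The freedom in \<open>S\<close> allows functions with different supports to be summed
  over one common set, and terms that happen to vanish to be kept.\<close>

lemma pushforward_eq_sum:
  assumes "y \<in> topspace Y" "finite S" "S \<subseteq> {x \<in> topspace X. p x = y}"
    "\<And>x. x \<in> topspace X \<Longrightarrow> p x = y \<Longrightarrow> f x \<noteq> 0 \<Longrightarrow> x \<in> S"
  shows "pushforward X Y p f y = sum f S"
  using assms by (auto simp: pushforward_def intro!: sum.mono_neutral_left)

lemma pushforward_cong:
  assumes "\<And>x. x \<in> topspace X \<Longrightarrow> p x = q x"
  shows "pushforward X Y p f = pushforward X Y q f"
  using assms by (auto simp: pushforward_def fun_eq_iff intro!: sum.cong)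

lemma pushforward_outside: "y \<notin> topspace Y \<Longrightarrow> pushforward X Y p f y = 0"
  by (simp add: pushforward_def)

text \<open>Separate each point from the compact set of the other points, then cut its neighbourhood
  down by the sets \<open>W\<close> that belong to those other points.\<close>

lemma disjoint_open_nbhds_finite:
  assumes X: "Hausdorff_space X" and F: "finite F" "F \<subseteq> topspace X"
  obtains U where "\<And>x. x \<in> F \<Longrightarrow> openin X (U x) \<and> x \<in> U x"
    "\<And>x x'. x \<in> F \<Longrightarrow> x' \<in> F \<Longrightarrow> x \<noteq> x' \<Longrightarrow> U x \<inter> U x' = {}"
proof -
  have "\<exists>U W. openin X U \<and> openin X W \<and> x \<in> U \<and> F - {x} \<subseteq> W \<and> U \<inter> W = {}" if x: "x \<in> F" for x
  proof -
    have "compactin X {x}" "compactin X (F - {x})"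
      using F x by (auto intro!: finite_imp_compactin)
    then show ?thesis
      using X unfolding Hausdorff_space_compact_sets disjnt_def
      by (metis Diff_disjoint insert_subset)
  qed
  then obtain U W where UW: "\<And>x. x \<in> F \<Longrightarrow> openin X (U x) \<and> openin X (W x) \<and> x \<in> U x \<and>
      F - {x} \<subseteq> W x \<and> U x \<inter> W x = {}"
    by metis
  \<comment> \<open>The entry \<open>topspace X\<close> keeps the intersection open when
    \<open>F\<close> has a single point.\<close>
  let ?V = "\<lambda>x. U x \<inter> \<Inter>(insert (topspace X) (W ` (F - {x})))"
  show ?thesis
  proof (rule that[of ?V])
    show "openin X (?V x) \<and> x \<in> ?V x" if "x \<in> F" for x
    proof
      have "openin X (\<Inter>(insert (topspace X) (W ` (F - {x}))))"
        by (rule openin_Inter) (use F UW in auto)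
      then show "openin X (?V x)" using UW that by blast
      show "x \<in> ?V x" using UW that F by blast
    qed
    show "?V x \<inter> ?V x' = {}" if "x \<in> F" "x' \<in> F" "x \<noteq> x'" for x x'
    proof -
      have "?V x \<subseteq> U x" "?V x' \<subseteq> W x" using that by auto
      then show ?thesis using UW[OF that(1)] by blast
    qed
  qed
qed

text \<open>Over a small neighbourhood of \<open>y\<close> the compact set \<open>K\<close> lies in
  finitely many sheets, one through each of its points above \<open>y\<close>. There the pushforward
  is a finite sum of \<open>f\<close> along local inverses.\<close>

lemma pushforward_Cc:
  assumes p: "local_homeomorphism X Y p" and X: "Hausdorff_space X" and Y: "Hausdorff_space Y"
    and f: "f \<in> Cc X"
  shows "pushforward X Y p f \<in> Cc Y"
proof -
  obtain K where K: "compactin X K" "\<And>x. f x \<noteq> 0 \<Longrightarrow> x \<in> K" using Cc_support[OF f] by blast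
  have KX: "K \<subseteq> topspace X" using K compactin_subset_topspace by blast
  have pc: "continuous_map X Y p" using p by (rule local_homeomorphism_continuous)
  have po: "\<And>U. openin X U \<Longrightarrow> openin Y (p ` U)"
    using local_homeomorphism_open_map[OF p] by (simp add: open_map_def)
  have loc: "\<exists>V. openin Y V \<and> y \<in> V \<and> continuous_map (subtopology Y V) euclidean (pushforward X Y p f)"
    if y: "y \<in> topspace Y" for y
  proof -
    define F where "F = {x \<in> K. p x = y}"
    have F: "finite F" "F \<subseteq> topspace X"
      using finite_fibre_compact[OF p Hausdorff_imp_t1_space[OF Y] K(1)] KX by (auto simp: F_def)
    obtain U1 where U1: "\<And>x. x \<in> F \<Longrightarrow> openin X (U1 x) \<and> x \<in> U1 x"
       "\<And>x x'. x \<in> F \<Longrightarrow> x' \<in> F \<Longrightarrow> x \<noteq> x' \<Longrightarrow> U1 x \<inter> U1 x' = {}"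
      using disjoint_open_nbhds_finite[OF X F] by metis
    obtain U2 where U2: "\<And>x. x \<in> topspace X \<Longrightarrow> openin X (U2 x) \<and> x \<in> U2 x \<and> inj_on p (U2 x)"
      using local_homeomorphism_locally_injective[OF p] by metis
    define U where "U x = U1 x \<inter> U2 x" for x
    have U: "openin X (U x)" "x \<in> U x" "inj_on p (U x)" if "x \<in> F" for x
      using U1(1)[OF that] U2[of x] F(2) that by (auto simp: U_def inj_on_Int)
    have Ud: "U x \<inter> U x' = {}" if "x \<in> F" "x' \<in> F" "x \<noteq> x'" for x x'
      using U1(2)[OF that] by (auto simp: U_def)
    \<comment> \<open>Lying in every sheet image gives each element of \<open>V\<close> one point
      above it per sheet. Removing the image of the rest of \<open>K\<close> ensures that nothing of
      the support is missed; this image is closed, being compact in a Hausdorff space. The entry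
      \<open>topspace Y\<close> covers an empty \<open>F\<close>.\<close>
    define V where "V = (\<Inter>(insert (topspace Y) ((\<lambda>x. p ` U x) ` F))) - p ` (K - \<Union>(U ` F))"
    have Vp: "V \<subseteq> p ` U x" if "x \<in> F" for x using that by (auto simp: V_def)
    have "openin X (\<Union>(U ` F))" using U by blast
    then have "closedin X (topspace X - \<Union>(U ` F))" by blast
    then have "compactin X ((topspace X - \<Union>(U ` F)) \<inter> K)"
      using K(1) closed_Int_compactin by blast
    moreover have "(topspace X - \<Union>(U ` F)) \<inter> K = K - \<Union>(U ` F)" using KX by blast
    ultimately have "compactin X (K - \<Union>(U ` F))" by simp
    then have "compactin Y (p ` (K - \<Union>(U ` F)))" using image_compactin pc by blast
    then have "closedin Y (p ` (K - \<Union>(U ` F)))" using compactin_imp_closedin Y by blast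
    moreover have "openin Y (\<Inter>(insert (topspace Y) ((\<lambda>x. p ` U x) ` F)))"
      by (rule openin_Inter) (use F U po in auto)
    ultimately have V: "openin Y V" unfolding V_def by (rule openin_diff[rotated])
    have VY: "V \<subseteq> topspace Y" using V openin_subset by blast
    have yV: "y \<in> V"
    proof -
      have "y \<in> p ` U x" if "x \<in> F" for x
        using U(2)[OF that] that by (auto simp: F_def)
      moreover have "y \<notin> p ` (K - \<Union>(U ` F))"
        using U(2) by (auto simp: F_def)
      ultimately show ?thesis using y by (auto simp: V_def)
    qed
    define t where "t x = inv_into (U x) p" for x
    have t: "t x y' \<in> U x" "p (t x y') = y'" if "x \<in> F" "y' \<in> V" for x y'
      using Vp[OF that(1)] that(2) by (auto simp: t_def intro: inv_into_into f_inv_into_f)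
    have tc: "continuous_map (subtopology Y V) X (t x)" if x: "x \<in> F" for x
      unfolding t_def
      using continuous_map_from_subtopology_mono[OF local_homeomorphism_section[OF p U(1,3)[OF x]] Vp[OF x]] .
    have eq: "pushforward X Y p f y' = (\<Sum>x\<in>F. f (t x y'))" if y': "y' \<in> V" for y'
    proof -
      have inj: "inj_on (\<lambda>x. t x y') F"
        using t[OF _ y'] Ud by (auto simp: inj_on_def) (metis disjoint_iff)
      have "pushforward X Y p f y' = sum f ((\<lambda>x. t x y') ` F)"
      proof (rule pushforward_eq_sum)
        show "y' \<in> topspace Y" using y' VY by blast
        show "finite ((\<lambda>x. t x y') ` F)" using F by simp
        show "(\<lambda>x. t x y') ` F \<subseteq> {x \<in> topspace X. p x = y'}"
          using t[OF _ y'] U(1) openin_subset by blast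
        fix z assume z: "z \<in> topspace X" "p z = y'" "f z \<noteq> 0"
        then have "z \<in> K" using K(2) by blast
        then obtain x where x: "x \<in> F" "z \<in> U x" using z y' by (auto simp: V_def)
        then have "t x y' = z" using U(3)[OF x(1)] z(2) by (simp add: t_def inv_into_f_eq)
        then show "z \<in> (\<lambda>x. t x y') ` F" using x by blast
      qed
      then show ?thesis using inj by (simp add: sum.reindex)
    qed
    have "continuous_map (subtopology Y V) euclidean (\<lambda>y'. \<Sum>x\<in>F. f (t x y'))"
    proof -
      have "continuous_map (subtopology Y V) euclidean (\<lambda>y'. f (t x y'))" if "x \<in> F" for x
        using continuous_map_compose[OF tc[OF that] Cc_D(1)[OF f]] by (simp add: o_def)
      then show ?thesis
        by (auto simp: continuous_map_atin intro!: tendsto_sum)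
    qed
    then have "continuous_map (subtopology Y V) euclidean (pushforward X Y p f)"
      by (rule continuous_map_eq) (use eq VY in auto)
    then show ?thesis using V yV by blast
  qed
  then obtain V where V: "\<And>y. y \<in> topspace Y \<Longrightarrow> openin Y (V y) \<and> y \<in> V y \<and>
      continuous_map (subtopology Y (V y)) euclidean (pushforward X Y p f)" by metis
  show ?thesis
  proof (rule Cc_I[OF Y])
    show "continuous_map Y euclidean (pushforward X Y p f)"
      by (rule pasting_lemma[where I = "topspace Y" and T = V and f = "\<lambda>_. pushforward X Y p f"])
        (use V in auto)
    show "compactin Y (p ` K)" using image_compactin pc K(1) by blast
    show "y \<in> p ` K" if "y \<in> topspace Y" and ne: "pushforward X Y p f y \<noteq> 0" for y
    proof -
      from that have "{x \<in> topspace X. p x = y \<and> f x \<noteq> 0} \<noteq> {}"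
        unfolding pushforward_def by (metis sum.empty)
      then show ?thesis using K(2) by blast
    qed
  qed (simp add: pushforward_outside)
qed

text \<open>Group the finitely many contributing points above \<open>z\<close> by their images in
  \<open>Y\<close>.\<close>

lemma pushforward_compose:
  assumes p: "local_homeomorphism X Y p" and q: "local_homeomorphism Y Z q"
    and Y: "Hausdorff_space Y" and Z: "Hausdorff_space Z" and f: "f \<in> Cc X"
  shows "pushforward Y Z q (pushforward X Y p f) = pushforward X Z (q \<circ> p) f"
proof
  fix z
  show "pushforward Y Z q (pushforward X Y p f) z = pushforward X Z (q \<circ> p) f z"
  proof (cases "z \<in> topspace Z")
    case True
    define S where "S = {x \<in> topspace X. (q \<circ> p) x = z \<and> f x \<noteq> 0}"
    have S: "finite S"
      unfolding S_def using finite_fibre_Cc[OF local_homeomorphism_compose[OF p q] Hausdorff_imp_t1_space[OF Z] f] .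
    have pX: "p x \<in> topspace Y" if "x \<in> topspace X" for x
      using that local_homeomorphism_continuous[OF p] by (auto simp: continuous_map_def)
    have eq: "pushforward X Y p f y = sum f {x \<in> S. p x = y}" if "y \<in> topspace Y" "q y = z" for y
    proof (rule pushforward_eq_sum[OF that(1)])
      show "finite {x \<in> S. p x = y}" using S by simp
    qed (use that in \<open>auto simp: S_def\<close>)
    \<comment> \<open>The inner pushforward may vanish by cancellation at some points of the image
      of \<open>S\<close>; such points stay in the index set.\<close>
    have "pushforward Y Z q (pushforward X Y p f) z = sum (pushforward X Y p f) (p ` S)"
    proof (rule pushforward_eq_sum[OF True])
      show "finite (p ` S)" using S by simp
      show "p ` S \<subseteq> {y \<in> topspace Y. q y = z}" using pX by (auto simp: S_def)
      show "y \<in> p ` S" if "y \<in> topspace Y" "q y = z" "pushforward X Y p f y \<noteq> 0" for y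
      proof -
        have "{x \<in> S. p x = y} \<noteq> {}" using eq[OF that(1,2)] that(3) by (metis sum.empty)
        then show ?thesis by blast
      qed
    qed
    also have "\<dots> = (\<Sum>y\<in>p ` S. sum f {x \<in> S. p x = y})"
      using pX by (intro sum.cong eq) (auto simp: S_def)
    also have "\<dots> = sum f S"
      using S by (rule sum.image_gen[symmetric])
    also have "\<dots> = pushforward X Z (q \<circ> p) f z"
      using True by (simp add: pushforward_def S_def)
    finally show ?thesis .
  qed (simp add: pushforward_outside)
qed

lemma pushforward_add:
  assumes p: "local_homeomorphism X Y p" and Y: "t1_space Y" and f: "f \<in> Cc X" and g: "g \<in> Cc X"
  shows "pushforward X Y p (\<lambda>x. f x + g x) = (\<lambda>y. pushforward X Y p f y + pushforward X Y p g y)"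
proof
  fix y
  show "pushforward X Y p (\<lambda>x. f x + g x) y = pushforward X Y p f y + pushforward X Y p g y"
  proof (cases "y \<in> topspace Y")
    case True
    \<comment> \<open>One finite index set for all three functions, since \<open>f + g\<close> can
      vanish where \<open>f\<close> and \<open>g\<close> do not.\<close>
    let ?S = "{x \<in> topspace X. p x = y \<and> f x \<noteq> 0} \<union> {x \<in> topspace X. p x = y \<and> g x \<noteq> 0}"
    have fin: "finite ?S" using finite_fibre_Cc[OF p Y] f g by blast
    have "pushforward X Y p h y = sum h ?S" if "\<And>x. h x \<noteq> 0 \<Longrightarrow> f x \<noteq> 0 \<or> g x \<noteq> 0" for h
      using that by (intro pushforward_eq_sum[OF True fin]) auto
    note eq = this
    have "f x \<noteq> 0 \<or> g x \<noteq> 0" if "f x + g x \<noteq> 0" for x using that by auto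
    then have "pushforward X Y p (\<lambda>x. f x + g x) y = (\<Sum>x\<in>?S. f x + g x)" by (rule eq)
    also have "\<dots> = sum f ?S + sum g ?S" by (rule sum.distrib)
    finally show ?thesis using eq[of f] eq[of g] by simp
  qed (simp add: pushforward_outside)
qed

lemma pushforward_minus: "pushforward X Y p (\<lambda>x. - f x) = (\<lambda>y. - pushforward X Y p f y)"
  by (auto simp: pushforward_def sum_negf)

lemma pushforward_zero: "pushforward X Y p (\<lambda>x. 0) = (\<lambda>y. 0)"
  by (auto simp: pushforward_def)

lemma pushforward_sum:
  assumes p: "local_homeomorphism X Y p" and X: "Hausdorff_space X" and Y: "t1_space Y"
    and f: "\<And>i. i \<in> I \<Longrightarrow> f i \<in> Cc X"
  shows "pushforward X Y p (\<lambda>x. \<Sum>i\<in>I. f i x) = (\<lambda>y. \<Sum>i\<in>I. pushforward X Y p (f i) y)"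
  using f
proof (induction I rule: infinite_finite_induct)
  case (insert i I)
  then show ?case
    using pushforward_add[OF p Y, of "f i" "\<lambda>x. \<Sum>i\<in>I. f i x"] Cc_sum[OF X, of I f] by auto
qed (simp_all add: pushforward_zero)

lemma pushforward_identity:
  assumes "f \<in> Cc X"
  shows "pushforward X X (\<lambda>x. x) f = f"
proof
  fix x
  show "pushforward X X (\<lambda>x. x) f x = f x"
  proof (cases "x \<in> topspace X")
    case True
    then show ?thesis using pushforward_eq_sum[OF True, of "{x}" X "\<lambda>x. x" f] by auto
  qed (simp add: pushforward_outside Cc_D(2)[OF assms])
qed

lemma pushforward_nonneg:
  fixes f :: "'x \<Rightarrow> int"
  assumes "\<And>x. f x \<ge> 0"
  shows "pushforward X Y p f y \<ge> 0"
  using assms by (simp add: pushforward_def sum_nonneg)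

subsection \<open>Etale groupoids\<close>

lemma groupoid_arrow:
  assumes "groupoid_axioms G" "g \<in> garr G"
  shows "gsrc G g \<in> garr G" "grng G g \<in> garr G" "gsrc G (gsrc G g) = gsrc G g"
    "grng G (gsrc G g) = gsrc G g" "gsrc G (grng G g) = grng G g" "grng G (grng G g) = grng G g"
    "gmul G (grng G g) g = g" "gmul G g (gsrc G g) = g" "ginv G g \<in> garr G"
    "gsrc G (ginv G g) = grng G g" "grng G (ginv G g) = gsrc G g"
    "gmul G g (ginv G g) = grng G g" "gmul G (ginv G g) g = gsrc G g"
  using assms unfolding groupoid_axioms_def by simp_all

lemma groupoid_mult:
  assumes "groupoid_axioms G" "g \<in> garr G" "h \<in> garr G" "gsrc G g = grng G h"
  shows "gmul G g h \<in> garr G" "gsrc G (gmul G g h) = gsrc G h" "grng G (gmul G g h) = grng G g"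
  using assms unfolding groupoid_axioms_def composable_def by blast+

lemma groupoid_assoc:
  assumes "groupoid_axioms G" "g \<in> garr G" "h \<in> garr G" "k \<in> garr G"
    "gsrc G g = grng G h" "gsrc G h = grng G k"
  shows "gmul G (gmul G g h) k = gmul G g (gmul G h k)"
  using assms unfolding groupoid_axioms_def composable_def by blast

lemma unitsD:
  assumes "groupoid_axioms G" "x \<in> units G"
  shows "x \<in> garr G" "gsrc G x = x" "grng G x = x"
  using assms groupoid_arrow(4)[of G x] by (auto simp: units_def)

lemma src_rng_in_units:
  assumes "groupoid_axioms G" "g \<in> garr G"
  shows "gsrc G g \<in> units G" "grng G g \<in> units G"
  using groupoid_arrow[OF assms] by (auto simp: units_def)

lemma groupoid_idempotent:
  assumes G: "groupoid_axioms G" and e: "e \<in> garr G" "gsrc G e = grng G e" "gmul G e e = e"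
  shows "e = gsrc G e"
proof -
  note a = groupoid_arrow[OF G e(1)]
  have "e = gmul G (gmul G (ginv G e) e) e" using a e by metis
  also have "\<dots> = gmul G (ginv G e) (gmul G e e)"
    using a e by (intro groupoid_assoc[OF G]) auto
  also have "\<dots> = gsrc G e" using a e by metis
  finally show ?thesis .
qed

lemma groupoid_left_cancel:
  assumes G: "groupoid_axioms G" and a: "a \<in> garr G" "b \<in> garr G" "c \<in> garr G"
    "gsrc G a = grng G b" "gsrc G a = grng G c" and eq: "gmul G a b = gmul G a c"
  shows "b = c"
proof -
  note A = groupoid_arrow[OF G a(1)]
  have "gmul G (ginv G a) (gmul G a d) = d" if "d \<in> garr G" "gsrc G a = grng G d" for d
    using groupoid_assoc[OF G A(9) a(1) that(1) A(10) that(2)] A(13) that groupoid_arrow(7)[OF G that(1)]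
    by simp
  then show ?thesis using a eq by metis
qed

lemma ginv_ginv:
  assumes G: "groupoid_axioms G" and g: "g \<in> garr G"
  shows "ginv G (ginv G g) = g"
proof -
  note a = groupoid_arrow[OF G g]
  note b = groupoid_arrow[OF G a(9)]
  have "ginv G (ginv G g) = gmul G (ginv G (ginv G g)) (gmul G (ginv G g) g)"
    using a b groupoid_arrow(8)[OF G b(9)] by metis
  also have "\<dots> = gmul G (gmul G (ginv G (ginv G g)) (ginv G g)) g"
    using a b by (intro groupoid_assoc[OF G, symmetric]) (auto simp: g)
  also have "\<dots> = g" using a b by metis
  finally show ?thesis .
qed

text \<open>\<open>groupoid_hom\<close> speaks of composable products only. A unit satisfies
  \<open>x x = x\<close>, so its image is an idempotent arrow and hence a unit. Since an arrow is
  composable with its source and its range, the images of these units must be the source and range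
  of the image.\<close>

lemma groupoid_homD:
  assumes G: "groupoid_axioms G" and H: "groupoid_axioms H" and f: "groupoid_hom G H f"
    and g: "g \<in> garr G"
  shows "f g \<in> garr H" "f (gsrc G g) = gsrc H (f g)" "f (grng G g) = grng H (f g)"
proof -
  note a = groupoid_arrow[OF G g]
  have c: "composable H (f a) (f b)" "f (gmul G a b) = gmul H (f a) (f b)" if "composable G a b" for a b
    using that f unfolding groupoid_hom_def by blast+
  have unit: "f x = gsrc H (f x) \<and> f x = grng H (f x)" if x: "x \<in> garr G" "gsrc G x = x" for x
  proof -
    have "x \<in> units G" using x by (auto simp: units_def)
    note u = unitsD[OF G this]
    have "composable G x x" "gmul G x x = x"
      using u groupoid_arrow(8)[OF G u(1)] by (auto simp: composable_def)
    then have "composable H (f x) (f x)" "gmul H (f x) (f x) = f x" using c[of x x] by auto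
    then show ?thesis using groupoid_idempotent[OF H] unfolding composable_def by metis
  qed
  have 1: "composable G g (gsrc G g)" "composable G (grng G g) g"
    using a g by (auto simp: composable_def)
  show "f g \<in> garr H" using c(1)[OF 1(1)] by (simp add: composable_def)
  show "f (gsrc G g) = gsrc H (f g)"
    using c(1)[OF 1(1)] unit[OF a(1) a(3)] by (simp add: composable_def)
  show "f (grng G g) = grng H (f g)"
    using c(1)[OF 1(2)] unit[OF a(2) a(5)] by (simp add: composable_def)
qed

lemma groupoid_hom_mult:
  assumes "groupoid_hom G H f" "g \<in> garr G" "h \<in> garr G" "gsrc G g = grng G h"
  shows "f (gmul G g h) = gmul H (f g) (f h)"
  using assms unfolding groupoid_hom_def composable_def by blast

lemma groupoid_hom_units:
  assumes "groupoid_axioms G" "groupoid_axioms H" "groupoid_hom G H f" "x \<in> units G"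
  shows "f x \<in> units H"
  using groupoid_homD[OF assms(1-3) unitsD(1)[OF assms(1,4)]] unitsD[OF assms(1,4)]
  by (auto simp: units_def)

lemma groupoid_hom_compose:
  assumes "groupoid_hom G H f" "groupoid_hom H K g"
  shows "groupoid_hom G K (g \<circ> f)"
  using assms unfolding groupoid_hom_def by (auto intro: continuous_map_compose)

lemma etale_hom_compose:
  assumes "etale_hom G H f" "etale_hom H K g"
  shows "etale_hom G K (g \<circ> f)"
  using assms unfolding etale_hom_def by (blast intro: groupoid_hom_compose local_homeomorphism_compose)

lemma etale_hom_id: "etale_hom G G id"
  unfolding etale_hom_def groupoid_hom_def
  by (auto intro: homeomorphic_map_imp_local_homeomorphism homeomorphic_map_id)

lemma etale_groupoidD:
  assumes "etale_groupoid G"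
  shows "groupoid_axioms G" "topspace (gtop G) = garr G" "Hausdorff_space (gtop G)"
    "continuous_map (gtop G) (gtop G) (ginv G)"
  using assms by (auto simp: etale_groupoid_def topological_groupoid_def)

lemma continuous_gmul:
  assumes G: "topological_groupoid G" and a: "continuous_map X (gtop G) a" and b: "continuous_map X (gtop G) b"
    and ab: "\<And>x. x \<in> topspace X \<Longrightarrow> gsrc G (a x) = grng G (b x)"
  shows "continuous_map X (gtop G) (\<lambda>x. gmul G (a x) (b x))"
proof -
  have t: "topspace (gtop G) = garr G" using G by (simp add: topological_groupoid_def)
  have "continuous_map X (prod_topology (gtop G) (gtop G)) (\<lambda>x. (a x, b x))"
    using a b by (simp add: continuous_map_pairedI)
  moreover have "(\<lambda>x. (a x, b x)) \<in> topspace X \<rightarrow> composable_pairs G"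
    using a b ab t by (auto simp: continuous_map_def composable_pairs_def composable_def)
  ultimately have "continuous_map X (subtopology (prod_topology (gtop G) (gtop G)) (composable_pairs G))
      (\<lambda>x. (a x, b x))"
    by (simp add: continuous_map_in_subtopology image_subset_iff_funcset)
  then have "continuous_map X (gtop G) ((\<lambda>(g, h). gmul G g h) \<circ> (\<lambda>x. (a x, b x)))"
    using G unfolding topological_groupoid_def by (blast intro: continuous_map_compose)
  then show ?thesis by (simp add: o_def)
qed

lemma topspace_unit_top:
  assumes "topspace (gtop G) = garr G"
  shows "topspace (unit_top G) = units G"
  using assms by (auto simp: unit_top_def units_def)

text \<open>Near a unit take \<open>U\<close> on which the range map is injective. If both
  \<open>g\<close> and its range lie in \<open>U\<close>, they have the same range and therefore
  coincide, so \<open>g\<close> is a unit. This lets the range map count as a local homeomorphism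
  into the whole arrow space.\<close>

lemma openin_units:
  assumes G: "etale_groupoid G"
  shows "openin (gtop G) (units G)"
proof (subst openin_subopen, intro ballI)
  fix x assume x: "x \<in> units G"
  note D = etale_groupoidD[OF G]
  note u = unitsD[OF D(1) x]
  have r: "local_homeomorphism (gtop G) (unit_top G) (grng G)" using G by (simp add: etale_groupoid_def)
  then have rc: "continuous_map (gtop G) (gtop G) (grng G)"
    using local_homeomorphism_continuous[OF r] by (simp add: unit_top_def continuous_map_in_subtopology)
  obtain U where U: "openin (gtop G) U" "x \<in> U" "inj_on (grng G) U"
    using local_homeomorphism_locally_injective[OF r, of x] u D by auto
  let ?W = "U \<inter> {g \<in> topspace (gtop G). grng G g \<in> U}"
  have "openin (gtop G) ?W"
    using U(1) rc by (blast intro: openin_continuous_map_preimage)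
  moreover have "?W \<subseteq> units G"
  proof
    fix g assume g: "g \<in> ?W"
    then have gG: "g \<in> garr G" using D(2) by auto
    have "grng G g = g"
      using U(3) g groupoid_arrow(6)[OF D(1) gG] by (auto simp: inj_on_def)
    then show "g \<in> units G" using src_rng_in_units[OF D(1) gG] by simp
  qed
  moreover have "x \<in> ?W" using U u D by auto
  ultimately show "\<exists>T. openin (gtop G) T \<and> x \<in> T \<and> T \<subseteq> units G" by blast
qed

lemma grng_local_homeomorphism:
  assumes G: "etale_groupoid G"
  shows "local_homeomorphism (gtop G) (gtop G) (grng G)"
  by (rule local_homeomorphism_into_open[OF _ openin_units[OF G]])
    (use G in \<open>simp add: etale_groupoid_def unit_top_def\<close>)

text \<open>The source map is the range map after inversion, and inversion is an involutive
  homeomorphism.\<close>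

lemma gsrc_local_homeomorphism:
  assumes G: "etale_groupoid G"
  shows "local_homeomorphism (gtop G) (gtop G) (gsrc G)"
proof -
  note D = etale_groupoidD[OF G]
  have "homeomorphic_maps (gtop G) (gtop G) (ginv G) (ginv G)"
    using D ginv_ginv[OF D(1)] by (auto simp: homeomorphic_maps_def)
  then have "local_homeomorphism (gtop G) (gtop G) (ginv G)"
    using homeomorphic_map_imp_local_homeomorphism homeomorphic_maps_map by blast
  from local_homeomorphism_compose[OF this grng_local_homeomorphism[OF G]]
  show ?thesis
    by (rule local_homeomorphism_cong) (use D groupoid_arrow(11) in auto)
qed

lemmas continuous_grng = local_homeomorphism_continuous[OF grng_local_homeomorphism]
lemmas continuous_gsrc = local_homeomorphism_continuous[OF gsrc_local_homeomorphism]

subsection \<open>Spaces of composable strings\<close>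

lemma strings_pos_iff:
  assumes "0 < n"
  shows "f \<in> strings G n \<longleftrightarrow> (\<forall>j<n. f j \<in> garr G) \<and> (\<forall>j\<ge>n. f j = undefined) \<and>
      (\<forall>j. Suc j < n \<longrightarrow> gsrc G (f j) = grng G (f (Suc j)))"
  using assms by (auto simp: strings_def PiE_iff extensional_def)

lemma strings_0_iff: "f \<in> strings G 0 \<longleftrightarrow> f 0 \<in> units G \<and> (\<forall>j\<ge>1. f j = undefined)"
proof
  assume "f 0 \<in> units G \<and> (\<forall>j\<ge>1. f j = undefined)"
  moreover then have "f = single (f 0)" by (auto simp: single_def fun_eq_iff)
  ultimately show "f \<in> strings G 0" by (auto simp: strings_def)
qed (auto simp: strings_def single_def)

text \<open>\<open>max n 1\<close> is the number of entries in degree \<open>n\<close>: a string of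
  degree 0 still carries one entry, a unit. Phrased this way, facts about entries hold uniformly in
  all degrees.\<close>

lemma strings_arrow:
  assumes "f \<in> strings G n" "j < max n 1"
  shows "f j \<in> garr G"
proof (cases "n = 0")
  case True
  then have "j = 0" "f 0 \<in> units G" using assms strings_0_iff[of f G] by auto
  then show ?thesis by (simp add: units_def)
next
  case False
  then show ?thesis using assms by (simp add: strings_pos_iff)
qed

lemma strings_undefined:
  assumes "f \<in> strings G n" "j \<ge> max n 1"
  shows "f j = undefined"
proof (cases "n = 0")
  case True
  then show ?thesis using assms strings_0_iff[of f G] by simp
next
  case False
  then show ?thesis using assms by (simp add: strings_pos_iff)
qed

lemma strings_composable:
  assumes "f \<in> strings G n" "Suc j < max n 1"
  shows "gsrc G (f j) = grng G (f (Suc j))"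
proof (cases "n = 0")
  case False
  then show ?thesis using assms by (simp add: strings_pos_iff)
qed (use assms in simp)

lemma strings_eqI:
  assumes "f \<in> strings G n" "g \<in> strings G n" "\<And>j. j < max n 1 \<Longrightarrow> f j = g j"
  shows "f = g"
proof
  fix j show "f j = g j"
    using assms strings_undefined[of f G n j] strings_undefined[of g G n j]
    by (cases "j < max n 1") (auto simp: not_less)
qed

lemma strings_extensional: "f \<in> strings G n \<Longrightarrow> f \<in> extensional {..<max n 1}"
  unfolding extensional_def by (simp add: strings_undefined not_less)

lemma strings_subset_PiE: "strings G n \<subseteq> PiE {..<max n 1} (\<lambda>_. garr G)"
proof
  fix f assume f: "f \<in> strings G n"
  show "f \<in> PiE {..<max n 1} (\<lambda>_. garr G)"
    unfolding PiE_iff using strings_arrow[OF f] strings_extensional[OF f] by blast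
qed

lemma topspace_strings_top:
  assumes "topspace (gtop G) = garr G"
  shows "topspace (strings_top G n) = strings G n"
  using assms strings_subset_PiE[of G n] by (auto simp: strings_top_def)

lemma Hausdorff_strings_top:
  assumes "Hausdorff_space (gtop G)"
  shows "Hausdorff_space (strings_top G n)"
  unfolding strings_top_def
  using assms by (intro Hausdorff_space_subtopology) (simp add: Hausdorff_space_product_topology)

lemma continuous_strings_nth:
  assumes "j < max n 1"
  shows "continuous_map (strings_top G n) (gtop G) (\<lambda>f. f j)"
  unfolding strings_top_def
  using assms by (intro continuous_map_from_subtopology continuous_map_product_projection) auto

lemma continuous_into_strings:
  assumes "\<And>x. x \<in> topspace X \<Longrightarrow> F x \<in> strings G n"
    "\<And>j. j < max n 1 \<Longrightarrow> continuous_map X (gtop G) (\<lambda>x. F x j)"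
  shows "continuous_map X (strings_top G n) F"
proof -
  have "F ` topspace X \<subseteq> extensional {..<max n 1}"
    using assms(1) strings_extensional by blast
  then show ?thesis
    using assms unfolding strings_top_def continuous_map_in_subtopology continuous_map_componentwise
    by auto
qed

lemma openin_strings_box:
  assumes G: "topspace (gtop G) = garr G" and "\<And>j. j < max n 1 \<Longrightarrow> openin (gtop G) (V j)"
  shows "openin (strings_top G n) {f \<in> strings G n. \<forall>j<max n 1. f j \<in> V j}"
proof -
  have "openin (product_topology (\<lambda>_. gtop G) {..<max n 1}) (PiE {..<max n 1} V)"
    using assms(2) by (auto simp: openin_PiE_gen)
  moreover have "{f \<in> strings G n. \<forall>j<max n 1. f j \<in> V j} = PiE {..<max n 1} V \<inter> strings G n"
    unfolding set_eq_iff Int_iff PiE_iff mem_Collect_eq using strings_extensional[of _ G n] by blast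
  ultimately show ?thesis by (auto simp: strings_top_def openin_subtopology)
qed

lemma openin_strings_boxE:
  assumes "openin (strings_top G n) W" "f \<in> W"
  obtains V where "\<And>j. j < max n 1 \<Longrightarrow> openin (gtop G) (V j)" "\<And>j. j < max n 1 \<Longrightarrow> f j \<in> V j"
    "{h \<in> strings G n. \<forall>j<max n 1. h j \<in> V j} \<subseteq> W"
proof -
  obtain T where T: "openin (product_topology (\<lambda>_. gtop G) {..<max n 1}) T" "W = T \<inter> strings G n"
    using assms(1) by (auto simp: strings_top_def openin_subtopology)
  then have "f \<in> T" using assms(2) by blast
  then obtain V where V: "\<forall>i\<in>{..<max n 1}. openin (gtop G) (V i)" "f \<in> PiE {..<max n 1} V"
      "PiE {..<max n 1} V \<subseteq> T"
    using T(1) unfolding openin_product_topology_alt by blast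
  show ?thesis
  proof (rule that[of V])
    show "{h \<in> strings G n. \<forall>j<max n 1. h j \<in> V j} \<subseteq> W"
    proof
      fix h assume h: "h \<in> {h \<in> strings G n. \<forall>j<max n 1. h j \<in> V j}"
      then have "h \<in> PiE {..<max n 1} V"
        unfolding PiE_iff using strings_extensional[of h G n] by blast
      then show "h \<in> W" using h V(3) T(2) by blast
    qed
  qed (use V in auto)
qed

text \<open>Induction on the length. By hypothesis the first vertices of the tails form an open set
  \<open>T\<close>; the first arrow then ranges over the part of \<open>V 0\<close> with source in
  \<open>T\<close>, and the range map is open.\<close>

lemma openin_first_vertex_image:
  assumes G: "etale_groupoid G" and V: "\<And>j. j < Suc n \<Longrightarrow> openin (gtop G) (V j)"
  shows "openin (gtop G) ((\<lambda>f. grng G (f 0)) ` {f \<in> strings G (Suc n). \<forall>j<Suc n. f j \<in> V j})"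
  using V
proof (induction n arbitrary: V)
  case 0
  note D = etale_groupoidD[OF G]
  have "(\<lambda>f. grng G (f 0)) ` {f \<in> strings G (Suc 0). \<forall>j<Suc 0. f j \<in> V j} = grng G ` V 0"
  proof
    show "grng G ` V 0 \<subseteq> (\<lambda>f. grng G (f 0)) ` {f \<in> strings G (Suc 0). \<forall>j<Suc 0. f j \<in> V j}"
    proof (rule image_subsetI)
      fix g assume g: "g \<in> V 0"
      have "single g \<in> {f \<in> strings G (Suc 0). \<forall>j<Suc 0. f j \<in> V j}"
        using g openin_subset[OF 0[of 0]] D(2) by (auto simp: strings_pos_iff single_def)
      then show "grng G g \<in> (\<lambda>f. grng G (f 0)) ` {f \<in> strings G (Suc 0). \<forall>j<Suc 0. f j \<in> V j}"
        by (rule rev_image_eqI) (simp add: single_def)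
    qed
  qed auto
  then show ?case
    using 0[of 0] local_homeomorphism_open_map[OF grng_local_homeomorphism[OF G]]
    by (simp add: open_map_def)
next
  case (Suc n)
  note D = etale_groupoidD[OF G]
  let ?T = "(\<lambda>f. grng G (f 0)) ` {f \<in> strings G (Suc n). \<forall>j<Suc n. f j \<in> V (Suc j)}"
  let ?B = "{f \<in> strings G (Suc (Suc n)). \<forall>j<Suc (Suc n). f j \<in> V j}"
  have T: "openin (gtop G) ?T"
    using Suc.IH[of "\<lambda>j. V (Suc j)"] Suc.prems by simp
  have "(\<lambda>f. grng G (f 0)) ` ?B = grng G ` (V 0 \<inter> {g \<in> topspace (gtop G). gsrc G g \<in> ?T})"
  proof (intro equalityI subsetI)
    fix x assume "x \<in> (\<lambda>f. grng G (f 0)) ` ?B"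
    then obtain f where f: "f \<in> strings G (Suc (Suc n))" "\<forall>j<Suc (Suc n). f j \<in> V j" "x = grng G (f 0)"
      by blast
    let ?f = "\<lambda>j. f (Suc j)"
    have "?f \<in> strings G (Suc n)"
      using f(1) by (simp add: strings_pos_iff)
    then have "grng G (f (Suc 0)) \<in> ?T"
      using f(2) by (intro rev_image_eqI[of ?f]) auto
    moreover have "gsrc G (f 0) = grng G (f (Suc 0))" "f 0 \<in> garr G"
      using f(1) by (auto simp: strings_pos_iff)
    ultimately show "x \<in> grng G ` (V 0 \<inter> {g \<in> topspace (gtop G). gsrc G g \<in> ?T})"
      using f(2,3) D(2) by auto
  next
    fix x assume "x \<in> grng G ` (V 0 \<inter> {g \<in> topspace (gtop G). gsrc G g \<in> ?T})"
    then obtain g f where g: "g \<in> V 0" "g \<in> garr G" "x = grng G g"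
        and f: "f \<in> strings G (Suc n)" "\<forall>j<Suc n. f j \<in> V (Suc j)" "gsrc G g = grng G (f 0)"
      using D(2) by auto
    let ?f = "case_nat g f"
    have "?f \<in> ?B"
      using g f by (auto simp: strings_pos_iff less_Suc_eq_0_disj split: nat.splits)
    then show "x \<in> (\<lambda>f. grng G (f 0)) ` ?B"
      by (rule rev_image_eqI) (simp add: g)
  qed
  moreover have "openin (gtop G) (V 0 \<inter> {g \<in> topspace (gtop G). gsrc G g \<in> ?T})"
    using Suc.prems[of 0] openin_continuous_map_preimage[OF continuous_gsrc[OF G] T] by blast
  ultimately show ?case
    using local_homeomorphism_open_map[OF grng_local_homeomorphism[OF G]]
    by (simp add: open_map_def)
qed

text \<open>Openness is checked on boxes. For injectivity, take a box on whose factors the range map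
  is injective: the first vertex determines the first arrow, whose source is the range of the second
  arrow, and so on along the string.\<close>

lemma first_vertex_local_homeomorphism:
  assumes G: "etale_groupoid G"
  shows "local_homeomorphism (strings_top G n) (gtop G) (\<lambda>f. grng G (f 0))"
  unfolding local_homeomorphism_iff
proof (intro conjI ballI)
  note D = etale_groupoidD[OF G]
  note top = topspace_strings_top[OF D(2)]
  show "continuous_map (strings_top G n) (gtop G) (\<lambda>f. grng G (f 0))"
    using continuous_map_compose[OF continuous_strings_nth continuous_grng[OF G], of 0 n]
    by (simp add: o_def)
  show "open_map (strings_top G n) (gtop G) (\<lambda>f. grng G (f 0))"
    unfolding open_map_def
  proof (intro allI impI)
    fix W assume W: "openin (strings_top G n) W"
    show "openin (gtop G) ((\<lambda>f. grng G (f 0)) ` W)"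
    proof (subst openin_subopen, intro ballI)
      fix x assume "x \<in> (\<lambda>f. grng G (f 0)) ` W"
      then obtain f where f: "f \<in> W" "x = grng G (f 0)" by blast
      obtain V where V: "\<And>j. j < max n 1 \<Longrightarrow> openin (gtop G) (V j)" "\<And>j. j < max n 1 \<Longrightarrow> f j \<in> V j"
        "{h \<in> strings G n. \<forall>j<max n 1. h j \<in> V j} \<subseteq> W"
        using openin_strings_boxE[OF W f(1)] by blast
      let ?T = "(\<lambda>f. grng G (f 0)) ` {h \<in> strings G n. \<forall>j<max n 1. h j \<in> V j}"
      have "openin (gtop G) ?T"
      proof (cases n)
        case 0
        have "?T = V 0 \<inter> units G"
        proof (intro equalityI subsetI)
          fix x assume x: "x \<in> V 0 \<inter> units G"
          then have "single x \<in> {h \<in> strings G n. \<forall>j<max n 1. h j \<in> V j}"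
            using 0 by (auto simp: strings_0_iff single_def)
          then show "x \<in> ?T"
            using unitsD(3)[OF D(1)] x by (intro rev_image_eqI[of "single x"]) (auto simp: single_def)
        qed (use 0 unitsD[OF D(1)] in \<open>auto simp: strings_0_iff\<close>)
        then show ?thesis using V(1)[of 0] openin_units[OF G] 0 by auto
      next
        case (Suc m)
        then have "max n 1 = Suc m" by simp
        then show ?thesis using openin_first_vertex_image[OF G, of m V] V(1) Suc by simp
      qed
      moreover have "x \<in> ?T"
        using f V(2) openin_subset[OF W] top by auto
      ultimately show "\<exists>T. openin (gtop G) T \<and> x \<in> T \<and> T \<subseteq> (\<lambda>f. grng G (f 0)) ` W"
        using V(3) by blast
    qed
  qed
  fix f assume "f \<in> topspace (strings_top G n)"
  then have f: "f \<in> strings G n" using top by simp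
  obtain U where U: "\<And>g. g \<in> garr G \<Longrightarrow> openin (gtop G) (U g) \<and> g \<in> U g \<and> inj_on (grng G) (U g)"
    using local_homeomorphism_locally_injective[OF grng_local_homeomorphism[OF G]] D(2) by metis
  let ?W = "{h \<in> strings G n. \<forall>j<max n 1. h j \<in> U (f j)}"
  have "openin (strings_top G n) ?W"
    using openin_strings_box[OF D(2), of n "\<lambda>j. U (f j)"] U strings_arrow[OF f] by blast
  moreover have "f \<in> ?W" using U strings_arrow[OF f] f by blast
  moreover have "inj_on (\<lambda>f. grng G (f 0)) ?W"
  proof (rule inj_onI)
    fix h k assume h: "h \<in> ?W" and k: "k \<in> ?W" and eq: "grng G (h 0) = grng G (k 0)"
    have "j < max n 1 \<Longrightarrow> h j = k j" for j
    proof (induction j)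
      case 0
      then show ?case using h k eq U[OF strings_arrow[OF f 0]] by (auto simp: inj_on_def)
    next
      case (Suc j)
      then have "grng G (h (Suc j)) = grng G (k (Suc j))"
        using h k strings_composable[of h G n j] strings_composable[of k G n j] by auto
      then show ?case using Suc.prems h k U[OF strings_arrow[OF f Suc.prems]] by (auto simp: inj_on_def)
    qed
    then show "h = k" using h k strings_eqI[of h G n k] by blast
  qed
  ultimately show "\<exists>U. openin (strings_top G n) U \<and> f \<in> U \<and> inj_on (\<lambda>f. grng G (f 0)) U" by blast
qed

text \<open>For the maps between string spaces that occur below, the first vertex of the image depends on
  the argument by a local homeomorphism, so cancellation leaves only continuity to be checked.\<close>

lemma strings_map_local_homeomorphism:
  assumes H: "etale_groupoid H" and F: "continuous_map X (strings_top H m) F"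
    and v: "local_homeomorphism X (gtop H) v"
    and eq: "\<And>x. x \<in> topspace X \<Longrightarrow> grng H (F x 0) = v x"
  shows "local_homeomorphism X (strings_top H m) F"
proof (rule local_homeomorphism_cancel[OF F first_vertex_local_homeomorphism[OF H]])
  show "local_homeomorphism X (gtop H) ((\<lambda>f. grng H (f 0)) \<circ> F)"
    using v by (rule local_homeomorphism_cong) (simp add: eq)
qed

text \<open>The map to the first entry is a local homeomorphism by cancellation, since its composite
  with the range map is the first vertex. The source of the first entry is where the face of index 0
  begins.\<close>

lemma second_vertex_local_homeomorphism:
  assumes G: "etale_groupoid G"
  shows "local_homeomorphism (strings_top G n) (gtop G) (\<lambda>f. gsrc G (f 0))"
proof -
  have "local_homeomorphism (strings_top G n) (gtop G) (\<lambda>f. f 0)"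
    by (rule local_homeomorphism_cancel[OF continuous_strings_nth grng_local_homeomorphism[OF G]])
      (use first_vertex_local_homeomorphism[OF G, of n] in \<open>simp_all add: o_def\<close>)
  from local_homeomorphism_compose[OF this gsrc_local_homeomorphism[OF G]]
  show ?thesis by (simp add: o_def)
qed

text \<open>One formula for inner and outer faces: for \<open>i = 0\<close> both tests on
  \<open>Suc j\<close> fail, and for \<open>i = n\<close> the first always succeeds below
  \<open>n - 1\<close>.\<close>

lemma face_nth:
  assumes "2 \<le> n" "i \<le> n"
  shows "face G n i f j = (if j < n - 1
    then if Suc j < i then f j else if Suc j = i then gmul G (f j) (f (Suc j)) else f (Suc j)
    else undefined)"
  using assms by (auto simp: face_def)

lemma face_1: "face G (Suc 0) i f = single (if i = 0 then gsrc G (f 0) else grng G (f 0))"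
  by (simp add: face_def)

lemma face_in_strings:
  assumes G: "groupoid_axioms G" and n: "0 < n" "i \<le> n" and f: "f \<in> strings G n"
  shows "face G n i f \<in> strings G (n - 1)"
proof (cases "n = 1")
  case True
  then show ?thesis
    using src_rng_in_units[OF G, of "f 0"] strings_arrow[OF f, of 0]
    by (auto simp: face_1 strings_0_iff single_def)
next
  case False
  then have n2: "2 \<le> n" using n by simp
  have a: "\<And>j. j < n \<Longrightarrow> f j \<in> garr G" and c: "\<And>j. Suc j < n \<Longrightarrow> gsrc G (f j) = grng G (f (Suc j))"
    using f n by (auto simp: strings_pos_iff)
  have m: "gmul G (f j) (f (Suc j)) \<in> garr G" "gsrc G (gmul G (f j) (f (Suc j))) = gsrc G (f (Suc j))"
    "grng G (gmul G (f j) (f (Suc j))) = grng G (f j)" if "Suc j < n" for j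
    using groupoid_mult[OF G a[of j] a[of "Suc j"] c[of j]] that by auto
  show ?thesis
    using n2 by (auto simp: strings_pos_iff face_nth[OF n2 n(2)] a m c)
qed

text \<open>Only the face of index 0 moves the first vertex; every other face keeps it, since a
  product has the range of its left factor.\<close>

lemma face_local_homeomorphism:
  assumes G: "etale_groupoid G" and n: "0 < n" "i \<le> n"
  shows "local_homeomorphism (strings_top G n) (strings_top G (n - 1)) (face G n i)"
proof (rule strings_map_local_homeomorphism[OF G])
  note D = etale_groupoidD[OF G]
  note top = topspace_strings_top[OF D(2)]
  have TG: "topological_groupoid G" using G by (simp add: etale_groupoid_def)
  show "continuous_map (strings_top G n) (strings_top G (n - 1)) (face G n i)"
  proof (rule continuous_into_strings)
    show "face G n i f \<in> strings G (n - 1)" if "f \<in> topspace (strings_top G n)" for f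
      using face_in_strings[OF D(1) n] that top by blast
    fix j assume j: "j < max (n - 1) 1"
    show "continuous_map (strings_top G n) (gtop G) (\<lambda>f. face G n i f j)"
    proof (cases "n = 1")
      case True
      then show ?thesis
        using j local_homeomorphism_continuous[OF first_vertex_local_homeomorphism[OF G, of 1]]
          local_homeomorphism_continuous[OF second_vertex_local_homeomorphism[OF G, of 1]]
        by (simp add: face_1 single_def)
    next
      case False
      then have n2: "2 \<le> n" and j: "Suc j < n" and j': "j < n - 1" using n j by auto
      have "continuous_map (strings_top G n) (gtop G) (\<lambda>f. gmul G (f j) (f (Suc j)))"
        using j top by (intro continuous_gmul[OF TG] continuous_strings_nth)
          (auto simp: strings_composable)
      then show ?thesis
        using j n2 continuous_strings_nth[of j n G] continuous_strings_nth[of "Suc j" n G]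
        by (cases "Suc j < i"; cases "Suc j = i") (simp_all add: face_nth[OF n2 n(2)] j' del: One_nat_def)
    qed
  qed
  show "local_homeomorphism (strings_top G n) (gtop G)
      (\<lambda>f. if i = 0 then gsrc G (f 0) else grng G (f 0))"
    using first_vertex_local_homeomorphism[OF G] second_vertex_local_homeomorphism[OF G]
    by (cases "i = 0") simp_all
  fix f assume "f \<in> topspace (strings_top G n)"
  then have f: "f \<in> strings G n" using top by simp
  show "grng G (face G n i f 0) = (if i = 0 then gsrc G (f 0) else grng G (f 0))"
  proof (cases "n = 1")
    case True
    then show ?thesis
      using groupoid_arrow[OF D(1) strings_arrow[OF f, of 0]] by (simp add: face_1 single_def)
  next
    case False
    then have n2: "2 \<le> n" using n by simp
    have c: "gsrc G (f 0) = grng G (f (Suc 0))" using strings_composable[OF f, of 0] n2 by simp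
    moreover have "grng G (gmul G (f 0) (f (Suc 0))) = grng G (f 0)"
      using groupoid_mult(3)[OF D(1) strings_arrow[OF f, of 0] strings_arrow[OF f, of "Suc 0"] c] n2 by simp
    ultimately show ?thesis using n2 by (auto simp: face_nth[OF n2 n(2)])
  qed
qed

section \<open>Maps of string spaces induced by homomorphisms\<close>

definition string_map :: "('a \<Rightarrow> 'b) \<Rightarrow> nat \<Rightarrow> (nat \<Rightarrow> 'a) \<Rightarrow> (nat \<Rightarrow> 'b)" where
  "string_map \<rho> n f = (\<lambda>j. if j < max n 1 then \<rho> (f j) else undefined)"

lemma string_map_in_strings:
  assumes G: "groupoid_axioms G" and H: "groupoid_axioms H" and \<rho>: "groupoid_hom G H \<rho>"
    and f: "f \<in> strings G n"
  shows "string_map \<rho> n f \<in> strings H n"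
proof (cases "n = 0")
  case True
  then show ?thesis
    using f groupoid_hom_units[OF G H \<rho>] by (auto simp: strings_0_iff string_map_def)
next
  case False
  then show ?thesis
    using f groupoid_homD[OF G H \<rho>, of "f _"]
    by (auto simp: strings_pos_iff string_map_def max_def) (metis Suc_lessD)
qed

lemma string_map_local_homeomorphism:
  assumes G: "etale_groupoid G" and H: "etale_groupoid H" and \<rho>: "etale_hom G H \<rho>"
  shows "local_homeomorphism (strings_top G n) (strings_top H n) (string_map \<rho> n)"
proof (rule strings_map_local_homeomorphism[OF H])
  note D = etale_groupoidD[OF G] and E = etale_groupoidD[OF H]
  note top = topspace_strings_top[OF D(2)]
  have hom: "groupoid_hom G H \<rho>" and lh: "local_homeomorphism (gtop G) (gtop H) \<rho>"
    using \<rho> by (auto simp: etale_hom_def)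
  show "continuous_map (strings_top G n) (strings_top H n) (string_map \<rho> n)"
  proof (rule continuous_into_strings)
    show "string_map \<rho> n f \<in> strings H n" if "f \<in> topspace (strings_top G n)" for f
      using string_map_in_strings[OF D(1) E(1) hom] that top by blast
    show "continuous_map (strings_top G n) (gtop H) (\<lambda>f. string_map \<rho> n f j)" if "j < max n 1" for j
      using that continuous_map_compose[OF continuous_strings_nth[OF that] local_homeomorphism_continuous[OF lh]]
      by (simp add: string_map_def o_def)
  qed
  show "local_homeomorphism (strings_top G n) (gtop H) (\<rho> \<circ> (\<lambda>f. grng G (f 0)))"
    using first_vertex_local_homeomorphism[OF G] lh by (rule local_homeomorphism_compose)
  show "grng H (string_map \<rho> n f 0) = (\<rho> \<circ> (\<lambda>f. grng G (f 0))) f"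
    if "f \<in> topspace (strings_top G n)" for f
    using that top groupoid_homD(3)[OF D(1) E(1) hom strings_arrow[of f G n 0]]
    by (simp add: string_map_def)
qed

lemma face_string_map:
  assumes G: "groupoid_axioms G" and H: "groupoid_axioms H" and \<rho>: "groupoid_hom G H \<rho>"
    and f: "f \<in> strings G n" and n: "0 < n" "i \<le> n"
  shows "face H n i (string_map \<rho> n f) = string_map \<rho> (n - 1) (face G n i f)"
proof (cases "n = 1")
  case True
  then show ?thesis
    using groupoid_homD[OF G H \<rho> strings_arrow[OF f, of 0]]
    by (auto simp: face_1 string_map_def single_def fun_eq_iff)
next
  case False
  then have n2: "2 \<le> n" using n by simp
  have "\<rho> (gmul G (f j) (f (Suc j))) = gmul H (\<rho> (f j)) (\<rho> (f (Suc j)))" if "Suc j < n" for j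
    using that f n by (intro groupoid_hom_mult[OF \<rho>]) (auto simp: strings_pos_iff)
  then show ?thesis
    using n2 by (auto simp: fun_eq_iff face_nth[OF n2 n(2)] string_map_def)
qed

subsection \<open>Prisms\<close>

text \<open>A string of \<open>n\<close> arrows has \<open>n + 1\<close> vertices, and for positive
  \<open>n\<close> the last is available only as a source. Sources are therefore used from index 1
  on.\<close>

definition vertex :: "'a groupoid \<Rightarrow> (nat \<Rightarrow> 'a) \<Rightarrow> nat \<Rightarrow> 'a" where
  "vertex G f j = (if j = 0 then grng G (f 0) else gsrc G (f (j - 1)))"

lemma vertex_eq_grng:
  assumes "f \<in> strings G n" "j < max n 1"
  shows "vertex G f j = grng G (f j)"
  using assms strings_composable[of f G n "j - 1"] by (cases "j = 0") (simp_all add: vertex_def)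

lemma vertex_in_units:
  assumes "groupoid_axioms G" "f \<in> strings G n" "j \<le> n"
  shows "vertex G f j \<in> units G"
  using src_rng_in_units[OF assms(1)] strings_arrow[OF assms(2), of 0]
    strings_arrow[OF assms(2), of "j - 1"] assms(3)
  by (auto simp: vertex_def)

text \<open>Simplicially, the face of index \<open>i\<close> omits vertex \<open>i\<close>, so later
  vertices move down by one.\<close>

lemma vertex_face:
  assumes G: "groupoid_axioms G" and f: "f \<in> strings G n" and n: "0 < n" "i \<le> n" and k: "k < n"
  shows "vertex G (face G n i f) k = vertex G f (if k < i then k else Suc k)"
proof (cases "n = 1")
  case True
  then show ?thesis
    using k n groupoid_arrow[OF G strings_arrow[OF f, of 0]]
    by (auto simp: face_1 single_def vertex_def)
next
  case False
  then have n2: "2 \<le> n" using n by simp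
  have a: "\<And>j. j < n \<Longrightarrow> f j \<in> garr G" and c: "\<And>j. Suc j < n \<Longrightarrow> gsrc G (f j) = grng G (f (Suc j))"
    using f n by (auto simp: strings_pos_iff)
  have m: "gsrc G (gmul G (f j) (f (Suc j))) = gsrc G (f (Suc j))"
    "grng G (gmul G (f j) (f (Suc j))) = grng G (f j)" if "Suc j < n" for j
    using groupoid_mult[OF G a[of j] a[of "Suc j"] c[of j]] that by auto
  show ?thesis
  proof (cases k)
    case 0
    then show ?thesis using n2 m[of 0] c[of 0] by (auto simp: vertex_def face_nth[OF n2 n(2)])
  next
    case (Suc l)
    then show ?thesis using n2 k m[of l] by (auto simp: vertex_def face_nth[OF n2 n(2)])
  qed
qed

text \<open>The simplices of the prism on a string, with \<open>\<theta>\<close> on the edges joining the \<open>\<sigma>\<close>-copy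
  to the \<open>\<rho>\<close>-copy; their alternating sum is the chain homotopy.\<close>

definition prism ::
  "'a groupoid \<Rightarrow> ('a \<Rightarrow> 'b) \<Rightarrow> ('a \<Rightarrow> 'b) \<Rightarrow> ('a \<Rightarrow> 'b) \<Rightarrow> nat \<Rightarrow> nat \<Rightarrow> (nat \<Rightarrow> 'a) \<Rightarrow> (nat \<Rightarrow> 'b)" where
  "prism G \<rho> \<sigma> \<theta> n j f = (\<lambda>i. if i < j then \<sigma> (f i) else if i = j then \<theta> (vertex G f j)
     else if i \<le> n then \<rho> (f (i - 1)) else undefined)"

text \<open>With arrows read from source to range, \<open>\<theta>\<close> is a continuous natural
  transformation from \<open>\<rho>\<close> to \<open>\<sigma>\<close>, and the last assumption is
  its naturality square.\<close>

locale groupoid_similarity =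
  fixes G :: "'a groupoid" and H :: "'b groupoid" and \<rho> \<sigma> \<theta> :: "'a \<Rightarrow> 'b"
  assumes G: "etale_groupoid G" and H: "etale_groupoid H"
    and etale_\<rho>: "etale_hom G H \<rho>" and etale_\<sigma>: "etale_hom G H \<sigma>"
    and \<theta>: "continuous_map (unit_top G) (gtop H) \<theta>"
      "\<And>g. g \<in> garr G \<Longrightarrow> composable H (\<theta> (grng G g)) (\<rho> g)"
      "\<And>g. g \<in> garr G \<Longrightarrow> composable H (\<sigma> g) (\<theta> (gsrc G g))"
      "\<And>g. g \<in> garr G \<Longrightarrow> gmul H (\<theta> (grng G g)) (\<rho> g) = gmul H (\<sigma> g) (\<theta> (gsrc G g))"
begin

lemmas GD = etale_groupoidD[OF G]
lemmas HD = etale_groupoidD[OF H]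

lemma hom_\<rho>: "groupoid_hom G H \<rho>" and hom_\<sigma>: "groupoid_hom G H \<sigma>"
  using etale_\<rho> etale_\<sigma> by (auto simp: etale_hom_def)

lemmas \<rho>D = groupoid_homD[OF GD(1) HD(1) hom_\<rho>]
lemmas \<sigma>D = groupoid_homD[OF GD(1) HD(1) hom_\<sigma>]

lemma \<theta>D:
  assumes "x \<in> units G"
  shows "\<theta> x \<in> garr H" "gsrc H (\<theta> x) = \<rho> x" "grng H (\<theta> x) = \<sigma> x"
proof -
  note u = unitsD[OF GD(1) assms]
  show "\<theta> x \<in> garr H" using \<theta>(2)[OF u(1)] u by (simp add: composable_def)
  show "gsrc H (\<theta> x) = \<rho> x" using \<theta>(2)[OF u(1)] u \<rho>D(3)[OF u(1)] by (simp add: composable_def)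
  show "grng H (\<theta> x) = \<sigma> x" using \<theta>(3)[OF u(1)] u \<sigma>D(2)[OF u(1)] by (simp add: composable_def)
qed

lemma prism_in_strings:
  assumes f: "f \<in> strings G n" and j: "j \<le> n"
  shows "prism G \<rho> \<sigma> \<theta> n j f \<in> strings H (Suc n)"
proof -
  note v = vertex_in_units[OF GD(1) f j]
  have arr: "prism G \<rho> \<sigma> \<theta> n j f i \<in> garr H" if "i < Suc n" for i
    using that j \<theta>D(1)[OF v] \<sigma>D(1)[OF strings_arrow[OF f, of i]] \<rho>D(1)[OF strings_arrow[OF f, of "i - 1"]]
    by (auto simp: prism_def)
  have "gsrc H (prism G \<rho> \<sigma> \<theta> n j f i) = grng H (prism G \<rho> \<sigma> \<theta> n j f (Suc i))" if i: "Suc i < Suc n" for i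
  proof -
    have fi: "f i \<in> garr G" using strings_arrow[OF f, of i] i by simp
    \<comment> \<open>The consecutive pair lies before the \<open>\<theta>\<close>-edge, ends with
      it, starts with it, or lies after it.\<close>
    consider "Suc i < j" | "Suc i = j" | "i = j" | "j < i" by linarith
    then show ?thesis
    proof cases
      case 1
      then have "gsrc G (f i) = grng G (f (Suc i))" "f (Suc i) \<in> garr G"
        using strings_composable[OF f, of i] strings_arrow[OF f, of "Suc i"] j by auto
      then show ?thesis using 1 fi \<sigma>D(2)[of "f i"] \<sigma>D(3)[of "f (Suc i)"] by (simp add: prism_def)
    next
      case 2
      have "gsrc H (\<sigma> (f i)) = grng H (\<theta> (gsrc G (f i)))" using \<theta>(3)[OF fi] by (simp add: composable_def)
      then show ?thesis using 2 by (auto simp: prism_def vertex_def)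
    next
      case 3
      have "gsrc H (\<theta> (grng G (f i))) = grng H (\<rho> (f i))" using \<theta>(2)[OF fi] by (simp add: composable_def)
      then show ?thesis using 3 i vertex_eq_grng[OF f, of i] by (simp add: prism_def)
    next
      case 4
      then have "gsrc G (f (i - 1)) = grng G (f i)" "f (i - 1) \<in> garr G"
        using strings_composable[OF f, of "i - 1"] strings_arrow[OF f, of "i - 1"] i by auto
      then show ?thesis using 4 i fi \<rho>D(2)[of "f (i - 1)"] \<rho>D(3)[of "f i"] by (simp add: prism_def)
    qed
  qed
  moreover have "prism G \<rho> \<sigma> \<theta> n j f i = undefined" if "i \<ge> Suc n" for i
    using that j by (simp add: prism_def)
  ultimately show ?thesis using arr by (simp add: strings_pos_iff)
qed

text \<open>Whether the prism simplex starts with a \<open>\<sigma>\<close>-entry or with the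
  \<open>\<theta>\<close>-edge, its first vertex is \<open>\<sigma>\<close> of the first vertex of
  the string, and \<open>\<sigma>\<close> is etale.\<close>

lemma prism_local_homeomorphism:
  assumes j: "j \<le> n"
  shows "local_homeomorphism (strings_top G n) (strings_top H (Suc n)) (prism G \<rho> \<sigma> \<theta> n j)"
proof (rule strings_map_local_homeomorphism[OF H])
  note top = topspace_strings_top[OF GD(2)]
  have cont: "continuous_map (gtop G) (gtop H) \<rho>" "continuous_map (gtop G) (gtop H) \<sigma>"
    using hom_\<rho> hom_\<sigma> by (auto simp: groupoid_hom_def)
  have entry: "continuous_map (strings_top G n) Y (\<lambda>f. \<tau> (f i))"
    if "i < max n 1" "continuous_map (gtop G) Y \<tau>" for i and \<tau> :: "'a \<Rightarrow> 'd" and Y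
    using continuous_map_compose[OF continuous_strings_nth[OF that(1)] that(2)] by (simp add: o_def)
  have "continuous_map (strings_top G n) (gtop G) (\<lambda>f. vertex G f j)"
    using j entry[OF _ continuous_grng[OF G], of 0] entry[OF _ continuous_gsrc[OF G], of "j - 1"]
    by (cases "j = 0") (simp_all add: vertex_def)
  moreover have "(\<lambda>f. vertex G f j) \<in> topspace (strings_top G n) \<rightarrow> units G"
    using vertex_in_units[OF GD(1) _ j] top by auto
  ultimately have "continuous_map (strings_top G n) (unit_top G) (\<lambda>f. vertex G f j)"
    by (simp add: unit_top_def continuous_map_in_subtopology image_subset_iff_funcset)
  from continuous_map_compose[OF this \<theta>(1)]
  have \<theta>v: "continuous_map (strings_top G n) (gtop H) (\<lambda>f. \<theta> (vertex G f j))" by (simp add: o_def)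
  show "continuous_map (strings_top G n) (strings_top H (Suc n)) (prism G \<rho> \<sigma> \<theta> n j)"
  proof (rule continuous_into_strings)
    show "prism G \<rho> \<sigma> \<theta> n j f \<in> strings H (Suc n)" if "f \<in> topspace (strings_top G n)" for f
      using prism_in_strings[OF _ j] that top by blast
    fix i assume "i < max (Suc n) 1"
    then have i: "i \<le> n" by simp
    consider "i < j" | "i = j" | "j < i" by linarith
    then show "continuous_map (strings_top G n) (gtop H) (\<lambda>f. prism G \<rho> \<sigma> \<theta> n j f i)"
    proof cases
      case 1
      then show ?thesis using j entry[OF _ cont(2), of i] by (simp add: prism_def)
    next
      case 2
      then show ?thesis using \<theta>v by (simp add: prism_def)
    next
      case 3
      then show ?thesis using i entry[OF _ cont(1), of "i - 1"] by (simp add: prism_def)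
    qed
  qed
  show "local_homeomorphism (strings_top G n) (gtop H) (\<sigma> \<circ> (\<lambda>f. grng G (f 0)))"
    using first_vertex_local_homeomorphism[OF G] etale_\<sigma> local_homeomorphism_compose
    unfolding etale_hom_def by blast
  fix f assume "f \<in> topspace (strings_top G n)"
  then have f: "f \<in> strings G n" using top by simp
  then have f0: "f 0 \<in> garr G" using strings_arrow[OF f, of 0] by simp
  show "grng H (prism G \<rho> \<sigma> \<theta> n j f 0) = (\<sigma> \<circ> (\<lambda>f. grng G (f 0))) f"
    using \<theta>D(3)[OF src_rng_in_units(2)[OF GD(1) f0]] \<sigma>D(3)[OF f0]
    by (auto simp: prism_def vertex_def)
qed

text \<open>Deleting the leading \<open>\<theta>\<close>-edge leaves the \<open>\<rho>\<close>-copy.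
  In degree 0 the prism is a single arrow and this face is its source. The other end of the prism is
  dual.\<close>

lemma face_prism_first:
  assumes f: "f \<in> strings G n"
  shows "face H (Suc n) 0 (prism G \<rho> \<sigma> \<theta> n 0 f) = string_map \<rho> n f"
proof (cases "n = 0")
  case True
  then have "f 0 \<in> units G" using f by (simp add: strings_0_iff)
  then show ?thesis
    using True \<theta>D(2)[of "f 0"] unitsD(3)[OF GD(1), of "f 0"]
    by (auto simp: face_1 prism_def vertex_def single_def string_map_def fun_eq_iff)
next
  case False
  then show ?thesis by (auto simp: face_nth prism_def string_map_def fun_eq_iff)
qed

lemma face_prism_last:
  assumes f: "f \<in> strings G n"
  shows "face H (Suc n) (Suc n) (prism G \<rho> \<sigma> \<theta> n n f) = string_map \<sigma> n f"
proof (cases "n = 0")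
  case True
  then have "f 0 \<in> units G" using f by (simp add: strings_0_iff)
  then show ?thesis
    using True \<theta>D(3)[of "f 0"] unitsD(3)[OF GD(1), of "f 0"]
    by (auto simp: face_1 prism_def vertex_def single_def string_map_def fun_eq_iff)
next
  case False
  then show ?thesis by (auto simp: face_nth prism_def string_map_def fun_eq_iff)
qed

text \<open>Adjacent prism simplices share a face. At position \<open>j - 1\<close> one of them
  multiplies a \<open>\<sigma>\<close>-entry with the following \<open>\<theta>\<close>-edge, the
  other a \<open>\<theta>\<close>-edge with the following \<open>\<rho>\<close>-entry; naturality
  equates the products.\<close>

lemma face_prism_middle:
  assumes f: "f \<in> strings G n" and j: "0 < j" "j \<le> n"
  shows "face H (Suc n) j (prism G \<rho> \<sigma> \<theta> n j f) = face H (Suc n) j (prism G \<rho> \<sigma> \<theta> n (j - 1) f)"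
proof
  fix k
  have n: "2 \<le> Suc n" "j \<le> Suc n" using j by auto
  show "face H (Suc n) j (prism G \<rho> \<sigma> \<theta> n j f) k = face H (Suc n) j (prism G \<rho> \<sigma> \<theta> n (j - 1) f) k"
  proof (cases "Suc k = j")
    case True
    then have fk: "f k \<in> garr G" and v: "vertex G f k = grng G (f k)"
      using j strings_arrow[OF f, of k] vertex_eq_grng[OF f, of k] by auto
    show ?thesis
      using True j \<theta>(4)[OF fk] v by (auto simp: face_nth[OF n] prism_def vertex_def[of G f j])
  next
    case False
    then show ?thesis by (auto simp: face_nth[OF n] prism_def)
  qed
qed

lemma hom_mult_adjacent:
  assumes f: "f \<in> strings G n" and k: "Suc k < n"
  shows "\<rho> (gmul G (f k) (f (Suc k))) = gmul H (\<rho> (f k)) (\<rho> (f (Suc k)))"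
    "\<sigma> (gmul G (f k) (f (Suc k))) = gmul H (\<sigma> (f k)) (\<sigma> (f (Suc k)))"
  using strings_arrow[OF f, of k] strings_arrow[OF f, of "Suc k"] strings_composable[OF f, of k] k
    groupoid_hom_mult[OF hom_\<rho>, of "f k" "f (Suc k)"] groupoid_hom_mult[OF hom_\<sigma>, of "f k" "f (Suc k)"]
  by auto

text \<open>A face of index below \<open>j\<close> alters only the \<open>\<sigma>\<close>-part, so
  it can be taken before building the prism; the \<open>\<theta>\<close>-edge moves back by one
  place.\<close>

lemma face_prism_below:
  assumes f: "f \<in> strings G n" and ij: "i < j" "j \<le> n"
  shows "face H (Suc n) i (prism G \<rho> \<sigma> \<theta> n j f) = prism G \<rho> \<sigma> \<theta> (n - 1) (j - 1) (face G n i f)"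
proof
  fix k
  have n: "2 \<le> Suc n" "i \<le> Suc n" "0 < n" "i \<le> n" using ij by auto
  consider "Suc k < j" | "Suc k = j" | "j < Suc k" "k < n" | "n \<le> k" by linarith
  then show "face H (Suc n) i (prism G \<rho> \<sigma> \<theta> n j f) k = prism G \<rho> \<sigma> \<theta> (n - 1) (j - 1) (face G n i f) k"
  proof cases
    case 1
    then have n2: "2 \<le> n" and k: "k < n - 1" "k < j - 1" "Suc k < n" using ij by auto
    show ?thesis
      using 1 k hom_mult_adjacent(2)[OF f, of k] by (auto simp: face_nth[OF n(1,2)] face_nth[OF n2 n(4)] prism_def)
  next
    case 2
    then have "vertex G (face G n i f) k = vertex G f j"
      using vertex_face[OF GD(1) f n(3,4), of k] ij by simp
    then show ?thesis using 2 ij by (auto simp: face_nth[OF n(1,2)] prism_def)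
  next
    case 3
    then have n2: "2 \<le> n" using ij by simp
    show ?thesis
      using 3 ij by (auto simp: face_nth[OF n(1,2)] face_nth[OF n2 n(4)] prism_def)
  next
    case 4
    then show ?thesis using ij by (auto simp: face_nth[OF n(1,2)] prism_def)
  qed
qed

text \<open>Here only the \<open>\<rho>\<close>-part is altered. Its entries stand one place later
  in the prism than in \<open>f\<close>, whence the index \<open>i - 1\<close> on the right.\<close>

lemma face_prism_above:
  assumes f: "f \<in> strings G n" and ij: "Suc j < i" "i \<le> Suc n"
  shows "face H (Suc n) i (prism G \<rho> \<sigma> \<theta> n j f) = prism G \<rho> \<sigma> \<theta> (n - 1) j (face G n (i - 1) f)"
proof
  fix k
  have n: "2 \<le> Suc n" "i \<le> Suc n" "0 < n" "i - Suc 0 \<le> n" using ij by auto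
  consider "k < j" | "k = j" | "j < k" "k < n" | "n \<le> k" by linarith
  then show "face H (Suc n) i (prism G \<rho> \<sigma> \<theta> n j f) k = prism G \<rho> \<sigma> \<theta> (n - 1) j (face G n (i - 1) f) k"
  proof cases
    case 1
    then have n2: "2 \<le> n" and k: "k < n - 1" "k < n" "Suc k < i - Suc 0" using ij by auto
    show ?thesis
      using 1 k ij by (simp add: face_nth[OF n(1,2)] face_nth[OF n2 n(4)] prism_def)
  next
    case 2
    have "j < i - Suc 0" using ij by linarith
    then have "vertex G (face G n (i - 1) f) k = vertex G f j"
      using 2 vertex_face[OF GD(1) f n(3,4), of k] ij by simp
    then show ?thesis using 2 ij by (auto simp: face_nth[OF n(1,2)] prism_def)
  next
    case 3
    then have n2: "2 \<le> n" using ij by simp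
    obtain l where l: "k = Suc l" using 3 by (cases k) auto
    show ?thesis
      using 3 ij l hom_mult_adjacent(1)[OF f, of l]
      by (auto simp: face_nth[OF n(1,2)] face_nth[OF n2 n(4)] prism_def)
  next
    case 4
    then show ?thesis using ij by (auto simp: face_nth[OF n(1,2)] prism_def)
  qed
qed

end

text \<open>The sign \<open>(-1)^i\<close> acting on a coefficient group that has no
  multiplication.\<close>

definition alternate :: "nat \<Rightarrow> 'c::ab_group_add \<Rightarrow> 'c" where
  "alternate i x = (if even i then x else - x)"

lemma alternate_simps:
  "alternate 0 x = x" "alternate (Suc i) x = - alternate i x" "alternate i 0 = 0"
  "alternate i (- x) = - alternate i x"
  "alternate i (alternate j x) = alternate (i + j) x" "alternate i (x + y) = alternate i x + alternate i y"
  by (auto simp: alternate_def)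

lemma alternate_sum: "alternate i (\<Sum>j\<in>J. f j) = (\<Sum>j\<in>J. alternate i (f j))"
  by (simp add: alternate_def sum_negf)

text \<open>Think of \<open>a i j\<close> as face \<open>i\<close> of prism simplex
  \<open>j\<close>, and of \<open>b j i\<close> as prism simplex \<open>j\<close> of face
  \<open>i\<close>. The diagonals \<open>i = j\<close> and \<open>i = j + 1\<close> telescope. The
  regions below and above them correspond, with opposite sign, to the terms of \<open>b\<close> with
  \<open>i \<le> j\<close> and with \<open>i > j\<close>.\<close>

lemma prism_sum:
  fixes a b :: "nat \<Rightarrow> nat \<Rightarrow> 'c::ab_group_add"
  assumes lo: "\<And>i j. i < j \<Longrightarrow> j \<le> n \<Longrightarrow> a i j = b (j - 1) i"
    and mid: "\<And>j. 0 < j \<Longrightarrow> j \<le> n \<Longrightarrow> a j j = a j (j - 1)"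
    and hi: "\<And>i j. Suc j < i \<Longrightarrow> i \<le> Suc n \<Longrightarrow> a i j = b j (i - 1)"
  shows "(\<Sum>i\<le>Suc n. \<Sum>j\<le>n. alternate (i + j) (a i j)) + (\<Sum>j<n. \<Sum>i\<le>n. alternate (i + j) (b j i))
     = a 0 0 - a (Suc n) n"
proof -
  have row: "(\<Sum>i\<le>Suc n. alternate (i + j) (a i j)) =
      (\<Sum>i<j. alternate (i + j) (a i j)) + (a j j - a (Suc j) j) +
      (\<Sum>i=Suc (Suc j)..Suc n. alternate (i + j) (a i j))" if j: "j \<le> n" for j
  proof -
    have "{..Suc n} = {..<j} \<union> ({j, Suc j} \<union> {Suc (Suc j)..Suc n})" using j by auto
    then have "(\<Sum>i\<le>Suc n. alternate (i + j) (a i j)) =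
      (\<Sum>i<j. alternate (i + j) (a i j)) + (\<Sum>i\<in>{j, Suc j} \<union> {Suc (Suc j)..Suc n}. alternate (i + j) (a i j))"
      by (simp only:) (rule sum.union_disjoint, auto)
    also have "(\<Sum>i\<in>{j, Suc j} \<union> {Suc (Suc j)..Suc n}. alternate (i + j) (a i j)) =
       (\<Sum>i\<in>{j, Suc j}. alternate (i + j) (a i j)) + (\<Sum>i=Suc (Suc j)..Suc n. alternate (i + j) (a i j))"
      by (rule sum.union_disjoint) auto
    also have "(\<Sum>i\<in>{j, Suc j}. alternate (i + j) (a i j)) = a j j - a (Suc j) j"
      by (simp add: alternate_def)
    finally show ?thesis by (simp add: add.assoc)
  qed
  have "(\<Sum>j\<le>n. a j j - a (Suc j) j) = a 0 0 - a (Suc n) n"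
  proof -
    \<comment> \<open>\<open>mid\<close> identifies \<open>a (Suc j) j\<close> with the next
      diagonal term only for \<open>j < n\<close>; the extra value at \<open>n + 1\<close> supplies
      the last one.\<close>
    let ?c = "\<lambda>j. if j \<le> n then a j j else a (Suc n) n"
    have "(\<Sum>j\<le>n. a j j - a (Suc j) j) = (\<Sum>j<Suc n. ?c j - ?c (Suc j))"
    proof (rule sum.cong)
      fix j assume j: "j \<in> {..<Suc n}"
      then have "a (Suc j) j = ?c (Suc j)" using mid[of "Suc j"] by (cases "j = n") auto
      then show "a j j - a (Suc j) j = ?c j - ?c (Suc j)" using j by simp
    qed auto
    also have "\<dots> = ?c 0 - ?c (Suc n)" by (rule sum_lessThan_telescope')
    finally show ?thesis by simp
  qed
  moreover have "(\<Sum>j\<le>n. \<Sum>i<j. alternate (i + j) (a i j)) = - (\<Sum>j<n. \<Sum>i\<le>j. alternate (i + j) (b j i))"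
  proof -
    have "(\<Sum>j\<le>n. \<Sum>i<j. alternate (i + j) (a i j)) =
        (\<Sum>i<0. alternate (i + 0) (a i 0)) + (\<Sum>j<n. \<Sum>i<Suc j. alternate (i + Suc j) (a i (Suc j)))"
      by (rule sum.atMost_shift)
    also have "\<dots> = (\<Sum>j<n. \<Sum>i\<le>j. - alternate (i + j) (b j i))"
      using lo by (auto simp: alternate_simps lessThan_Suc_atMost intro!: sum.cong)
    finally show ?thesis by (simp add: sum_negf)
  qed
  moreover have "(\<Sum>j\<le>n. \<Sum>i=Suc (Suc j)..Suc n. alternate (i + j) (a i j))
      = - (\<Sum>j<n. \<Sum>i=Suc j..n. alternate (i + j) (b j i))"
  proof -
    have "(\<Sum>j\<le>n. \<Sum>i=Suc (Suc j)..Suc n. alternate (i + j) (a i j))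
      = (\<Sum>j\<le>n. \<Sum>i=Suc j..n. alternate (Suc i + j) (a (Suc i) j))"
      by (simp only: sum.shift_bounds_cl_Suc_ivl)
    also have "\<dots> = (\<Sum>j\<le>n. \<Sum>i=Suc j..n. - alternate (i + j) (b j i))"
      using hi by (auto simp: alternate_simps intro!: sum.cong)
    \<comment> \<open>For \<open>j = n\<close> the inner range is empty.\<close>
    also have "\<dots> = (\<Sum>j<n. \<Sum>i=Suc j..n. - alternate (i + j) (b j i))"
      by (simp add: lessThan_Suc_atMost[symmetric])
    finally show ?thesis by (simp add: sum_negf)
  qed
  moreover have "(\<Sum>j<n. \<Sum>i\<le>n. alternate (i + j) (b j i)) =
      (\<Sum>j<n. \<Sum>i\<le>j. alternate (i + j) (b j i)) + (\<Sum>j<n. \<Sum>i=Suc j..n. alternate (i + j) (b j i))"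
  proof -
    have "(\<Sum>i\<le>n. alternate (i + j) (b j i)) =
        (\<Sum>i\<le>j. alternate (i + j) (b j i)) + (\<Sum>i=Suc j..n. alternate (i + j) (b j i))" if "j < n" for j
    proof -
      have "{..n} = {..j} \<union> {Suc j..n}" using that by auto
      then show ?thesis by (simp only:) (rule sum.union_disjoint, auto)
    qed
    then show ?thesis by (simp add: sum.distrib)
  qed
  moreover have "(\<Sum>i\<le>Suc n. \<Sum>j\<le>n. alternate (i + j) (a i j)) =
    (\<Sum>j\<le>n. (\<Sum>i<j. alternate (i + j) (a i j)) + (a j j - a (Suc j) j) +
      (\<Sum>i=Suc (Suc j)..Suc n. alternate (i + j) (a i j)))"
    by (subst sum.swap, rule sum.cong) (use row in auto)
  ultimately show ?thesis by (simp add: sum.distrib)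
qed

subsection \<open>Chain maps and homology\<close>

lemma boundary_eq:
  "boundary G n f = (\<lambda>y. \<Sum>i\<le>n. alternate i (pushforward (strings_top G n) (strings_top G (n - 1)) (face G n i) f y))"
  unfolding boundary_def alternate_def atMost_atLeast0 ..

lemma Cc_alternate: "f \<in> Cc X \<Longrightarrow> (\<lambda>x. alternate i (f x)) \<in> Cc X"
  by (cases "even i") (simp_all add: alternate_def Cc_minus)

lemma pushforward_alternate:
  "pushforward X Y p (\<lambda>x. alternate i (f x)) = (\<lambda>y. alternate i (pushforward X Y p f y))"
  by (cases "even i") (simp_all add: alternate_def pushforward_minus)

text \<open>With this, identities between boundaries, chain maps and prism operators reduce to
  identities between composite maps of strings.\<close>

lemma pushforward_alternating_sum:
  assumes q: "local_homeomorphism Y Z q" and p: "\<And>i. i \<in> I \<Longrightarrow> local_homeomorphism X Y (p i)"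
    and X: "Hausdorff_space X" and Y: "Hausdorff_space Y" and Z: "Hausdorff_space Z" and f: "f \<in> Cc X"
  shows "pushforward Y Z q (\<lambda>y. \<Sum>i\<in>I. alternate (e i) (pushforward X Y (p i) f y)) z =
    (\<Sum>i\<in>I. alternate (e i) (pushforward X Z (q \<circ> p i) f z))"
proof -
  have "pushforward Y Z q (\<lambda>y. \<Sum>i\<in>I. alternate (e i) (pushforward X Y (p i) f y)) z =
     (\<Sum>i\<in>I. pushforward Y Z q (\<lambda>y. alternate (e i) (pushforward X Y (p i) f y)) z)"
    by (subst pushforward_sum[OF q Y Hausdorff_imp_t1_space[OF Z]])
      (auto intro!: Cc_alternate pushforward_Cc p X Y f)
  also have "\<dots> = (\<Sum>i\<in>I. alternate (e i) (pushforward X Z (q \<circ> p i) f z))"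
    using pushforward_compose[OF p q Y Z f] by (simp add: pushforward_alternate)
  finally show ?thesis .
qed

section \<open>Chains, boundaries and homology classes\<close>

locale etale_setting =
  fixes G :: "'a groupoid"
  assumes G: "etale_groupoid G"
begin

lemmas GD = etale_groupoidD[OF G]

lemma Hausdorff: "Hausdorff_space (strings_top G n)"
  by (rule Hausdorff_strings_top[OF GD(3)])

lemma boundary_add:
  assumes "f \<in> chains G (Suc n)" "g \<in> chains G (Suc n)"
  shows "boundary G (Suc n) (\<lambda>x. f x + g x) = (\<lambda>y. boundary G (Suc n) f y + boundary G (Suc n) g y)"
proof -
  have "pushforward (strings_top G (Suc n)) (strings_top G n) (face G (Suc n) i) (\<lambda>x. f x + g x) =
     (\<lambda>y. pushforward (strings_top G (Suc n)) (strings_top G n) (face G (Suc n) i) f y +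
       pushforward (strings_top G (Suc n)) (strings_top G n) (face G (Suc n) i) g y)" if "i \<le> Suc n" for i
    using face_local_homeomorphism[OF G _ that] assms
    by (intro pushforward_add Hausdorff_imp_t1_space Hausdorff) (auto simp: chains_def)
  then show ?thesis
    unfolding boundary_eq by (simp add: alternate_simps sum.distrib fun_eq_iff)
qed

lemma boundary_minus: "boundary G n (\<lambda>x. - f x) = (\<lambda>y. - boundary G n f y)"
  unfolding boundary_eq by (simp add: pushforward_minus alternate_simps sum_negf)

lemma chains_closed:
  "(\<lambda>_. 0) \<in> chains G n" "f \<in> chains G n \<Longrightarrow> g \<in> chains G n \<Longrightarrow> (\<lambda>x. f x + g x) \<in> chains G n"
  "f \<in> chains G n \<Longrightarrow> (\<lambda>x. - f x) \<in> chains G n"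
  by (auto simp: chains_def Cc_zero Cc_minus intro: Cc_add Hausdorff)

lemma cycles_add:
  assumes "f \<in> cycles G n" "g \<in> cycles G n"
  shows "(\<lambda>x. f x + g x) \<in> cycles G n"
proof (cases n)
  case (Suc m)
  then show ?thesis using assms boundary_add[of f m g] chains_closed(2)[of f "Suc m" g]
    by (auto simp: cycles_def)
qed (use assms chains_closed in \<open>auto simp: cycles_def\<close>)

lemma boundaries_closed:
  fixes f g :: "(nat \<Rightarrow> 'a) \<Rightarrow> 'c::topological_ab_group_add"
  shows "(\<lambda>_. 0 :: 'c) \<in> boundaries G n"
  "f \<in> boundaries G n \<Longrightarrow> g \<in> boundaries G n \<Longrightarrow> (\<lambda>x. f x + g x) \<in> boundaries G n"
  "f \<in> boundaries G n \<Longrightarrow> (\<lambda>x. - f x) \<in> boundaries G n"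
proof -
  have "boundary G (Suc n) (\<lambda>_. 0) = (\<lambda>_. 0 :: 'c)"
    by (simp add: boundary_eq pushforward_zero alternate_simps)
  then show "(\<lambda>_. 0 :: 'c) \<in> boundaries G n"
    unfolding boundaries_def using chains_closed(1) by (intro image_eqI[of _ _ "\<lambda>_. 0"]) simp_all
  show "(\<lambda>x. f x + g x) \<in> boundaries G n" if f: "f \<in> boundaries G n" and g: "g \<in> boundaries G n"
  proof -
    obtain c d where cd: "c \<in> chains G (Suc n)" "d \<in> chains G (Suc n)"
       "f = boundary G (Suc n) c" "g = boundary G (Suc n) d"
      using f g by (auto simp: boundaries_def)
    then have "(\<lambda>x. f x + g x) = boundary G (Suc n) (\<lambda>x. c x + d x)"
      using boundary_add[OF cd(1,2)] by simp
    then show ?thesis using cd chains_closed(2) by (auto simp: boundaries_def)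
  qed
  show "(\<lambda>x. - f x) \<in> boundaries G n" if f: "f \<in> boundaries G n"
  proof -
    obtain c where c: "c \<in> chains G (Suc n)" "f = boundary G (Suc n) c"
      using f by (auto simp: boundaries_def)
    then have "(\<lambda>x. - f x) = boundary G (Suc n) (\<lambda>x. - c x)"
      using boundary_minus[of "Suc n" c] by simp
    then show ?thesis using c chains_closed(3) by (auto simp: boundaries_def)
  qed
qed

abbreviation homology_class :: "nat \<Rightarrow> ((nat \<Rightarrow> 'a) \<Rightarrow> 'c::topological_ab_group_add) \<Rightarrow> _" where
  "homology_class n z \<equiv> r_coset (cycle_group G n) (boundaries G n) z"

text \<open>Cosets of the boundaries are handled inside the group of all functions, so that boundaries
  need not be known to be cycles.\<close>

lemma homology_class_eq: "homology_class n z = {\<lambda>x. b x + z x |b. b \<in> boundaries G n}"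
  by (auto simp: r_coset_def cycle_group_def)

lemma homology_classI: "b \<in> boundaries G n \<Longrightarrow> w = (\<lambda>x. b x + z x) \<Longrightarrow> w \<in> homology_class n z"
  by (auto simp: homology_class_eq)

lemma homology_classE:
  assumes "w \<in> homology_class n z"
  obtains b where "b \<in> boundaries G n" "w = (\<lambda>x. b x + z x)"
  using assms by (auto simp: homology_class_eq)

lemma homology_class_eq_iff:
  "homology_class n z = homology_class n z' \<longleftrightarrow> (\<lambda>x. z x - z' x) \<in> boundaries G n"
proof
  assume "homology_class n z = homology_class n z'"
  moreover have "z \<in> homology_class n z"
    by (rule homology_classI[OF boundaries_closed(1)]) simp
  ultimately obtain b where "b \<in> boundaries G n" "z = (\<lambda>x. b x + z' x)"
    using homology_classE[of z n z'] by auto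
  then show "(\<lambda>x. z x - z' x) \<in> boundaries G n" by simp
next
  have sub: "homology_class n z \<subseteq> homology_class n z'"
    if d: "(\<lambda>x. z x - z' x) \<in> boundaries G n" for z z' :: "(nat \<Rightarrow> 'a) \<Rightarrow> 'c::topological_ab_group_add"
  proof
    fix w assume "w \<in> homology_class n z"
    then obtain b where b: "b \<in> boundaries G n" "w = (\<lambda>x. b x + z x)"
      by (rule homology_classE)
    show "w \<in> homology_class n z'"
      by (rule homology_classI[OF boundaries_closed(2)[OF b(1) d]]) (simp add: b)
  qed
  assume d: "(\<lambda>x. z x - z' x) \<in> boundaries G n"
  have "(\<lambda>x. z' x - z x) \<in> boundaries G n" using boundaries_closed(3)[OF d] by simp
  then show "homology_class n z = homology_class n z'" using sub d by blast
qed

lemma carrier_homology: "carrier (homology G n) = homology_class n ` cycles G n"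
  by (auto simp: homology_def FactGroup_def RCOSETS_def cycle_group_def)

lemma mult_homology:
  "monoid.mult (homology G n) (homology_class n z) (homology_class n z') = homology_class n (\<lambda>x. z x + z' x)"
proof -
  have "monoid.mult (homology G n) (homology_class n z) (homology_class n z') =
     (\<Union>v\<in>homology_class n z. \<Union>v'\<in>homology_class n z'. {\<lambda>x. v x + v' x})"
    by (simp add: homology_def FactGroup_def set_mult_def) (simp add: cycle_group_def)
  also have "\<dots> = homology_class n (\<lambda>x. z x + z' x)"
  proof (intro equalityI subsetI)
    fix w assume "w \<in> (\<Union>v\<in>homology_class n z. \<Union>v'\<in>homology_class n z'. {\<lambda>x. v x + v' x})"
    then obtain v v' where v: "v \<in> homology_class n z" "v' \<in> homology_class n z'" and w: "w = (\<lambda>x. v x + v' x)"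
      by blast
    obtain b where b: "b \<in> boundaries G n" "v = (\<lambda>x. b x + z x)" using v(1) by (rule homology_classE)
    obtain b' where b': "b' \<in> boundaries G n" "v' = (\<lambda>x. b' x + z' x)" using v(2) by (rule homology_classE)
    show "w \<in> homology_class n (\<lambda>x. z x + z' x)"
      by (rule homology_classI[OF boundaries_closed(2)[OF b(1) b'(1)]]) (simp add: w b b' algebra_simps)
  next
    fix w assume "w \<in> homology_class n (\<lambda>x. z x + z' x)"
    then obtain b where b: "b \<in> boundaries G n" "w = (\<lambda>x. b x + (z x + z' x))"
      by (rule homology_classE)
    \<comment> \<open>The whole boundary is charged to the first factor; the second is represented
      by \<open>z'\<close> itself.\<close>
    have "(\<lambda>x. b x + z x) \<in> homology_class n z" by (rule homology_classI[OF b(1)]) simp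
    moreover have "z' \<in> homology_class n z'" by (rule homology_classI[OF boundaries_closed(1)]) simp
    moreover have "w = (\<lambda>x. (b x + z x) + z' x)" using b(2) by (simp add: algebra_simps)
    ultimately show "w \<in> (\<Union>v\<in>homology_class n z. \<Union>v'\<in>homology_class n z'. {\<lambda>x. v x + v' x})"
      by (intro UN_I) auto
  qed
  finally show ?thesis .
qed

end

section \<open>Chain maps induced by etale homomorphisms\<close>

definition chain_map ::
  "'a groupoid \<Rightarrow> 'b groupoid \<Rightarrow> ('a \<Rightarrow> 'b) \<Rightarrow> nat \<Rightarrow> ((nat \<Rightarrow> 'a) \<Rightarrow> 'c::topological_ab_group_add) \<Rightarrow> (nat \<Rightarrow> 'b) \<Rightarrow> 'c" where
  "chain_map G H \<rho> n = pushforward (strings_top G n) (strings_top H n) (string_map \<rho> n)"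

locale etale_homomorphism = dom: etale_setting G + cod: etale_setting H
  for G :: "'a groupoid" and H :: "'b groupoid" +
  fixes \<rho> :: "'a \<Rightarrow> 'b"
  assumes \<rho>: "etale_hom G H \<rho>"
begin

lemma hom: "groupoid_hom G H \<rho>"
  using \<rho> by (simp add: etale_hom_def)

lemmas string_map_lh = string_map_local_homeomorphism[OF dom.G cod.G \<rho>]

lemma chain_map_in_chains: "f \<in> chains G n \<Longrightarrow> chain_map G H \<rho> n f \<in> chains H n"
  unfolding chains_def chain_map_def
  by (intro pushforward_Cc[OF string_map_lh] dom.Hausdorff cod.Hausdorff)

lemma chain_map_add:
  assumes "f \<in> chains G n" "g \<in> chains G n"
  shows "chain_map G H \<rho> n (\<lambda>x. f x + g x) = (\<lambda>y. chain_map G H \<rho> n f y + chain_map G H \<rho> n g y)"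
  using assms unfolding chains_def chain_map_def
  by (intro pushforward_add[OF string_map_lh] Hausdorff_imp_t1_space cod.Hausdorff)

lemma chain_map_diff:
  assumes f: "f \<in> chains G n" and g: "g \<in> chains G n"
  shows "chain_map G H \<rho> n (\<lambda>x. f x - g x) = (\<lambda>y. chain_map G H \<rho> n f y - chain_map G H \<rho> n g y)"
proof -
  have "chain_map G H \<rho> n (\<lambda>x. - g x) = (\<lambda>y. - chain_map G H \<rho> n g y)"
    by (simp add: chain_map_def pushforward_minus)
  then show ?thesis using chain_map_add[OF f dom.chains_closed(3)[OF g]] by simp
qed

text \<open>Both sides expand into pushforwards along composites of a face with a string map, and
  these composites agree because homomorphisms commute with faces.\<close>

lemma boundary_chain_map:
  assumes f: "f \<in> chains G (Suc n)"
  shows "boundary H (Suc n) (chain_map G H \<rho> (Suc n) f) = chain_map G H \<rho> n (boundary G (Suc n) f)"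
proof
  fix y
  let ?X = "strings_top G (Suc n)" and ?Y = "strings_top H n"
  have f': "f \<in> Cc ?X" using f by (simp add: chains_def)
  have top: "topspace ?X = strings G (Suc n)" by (rule topspace_strings_top[OF dom.GD(2)])
  have fH: "local_homeomorphism (strings_top H (Suc n)) ?Y (face H (Suc n) i)"
    and fG: "local_homeomorphism ?X (strings_top G n) (face G (Suc n) i)" if "i \<le> Suc n" for i
    using face_local_homeomorphism[OF cod.G _ that] face_local_homeomorphism[OF dom.G _ that] by simp_all
  have "boundary H (Suc n) (chain_map G H \<rho> (Suc n) f) y =
      (\<Sum>i\<le>Suc n. alternate i (pushforward ?X ?Y (face H (Suc n) i \<circ> string_map \<rho> (Suc n)) f y))"
    unfolding boundary_eq chain_map_def
    using pushforward_compose[OF string_map_lh fH cod.Hausdorff cod.Hausdorff f'] by simp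
  also have "\<dots> = (\<Sum>i\<le>Suc n. alternate i (pushforward ?X ?Y (string_map \<rho> n \<circ> face G (Suc n) i) f y))"
  proof (rule sum.cong)
    fix i assume "i \<in> {..Suc n}"
    then have "pushforward ?X ?Y (face H (Suc n) i \<circ> string_map \<rho> (Suc n)) f =
       pushforward ?X ?Y (string_map \<rho> n \<circ> face G (Suc n) i) f"
      using face_string_map[OF dom.GD(1) cod.GD(1) hom, of _ "Suc n" i] top
      by (intro pushforward_cong) simp
    then show "alternate i (pushforward ?X ?Y (face H (Suc n) i \<circ> string_map \<rho> (Suc n)) f y) =
       alternate i (pushforward ?X ?Y (string_map \<rho> n \<circ> face G (Suc n) i) f y)" by simp
  qed simp
  also have "\<dots> = chain_map G H \<rho> n (boundary G (Suc n) f) y"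
    unfolding chain_map_def boundary_eq diff_Suc_1
    by (rule pushforward_alternating_sum[symmetric, where e = "\<lambda>i. i"])
      (auto intro: string_map_lh fG dom.Hausdorff cod.Hausdorff f')
  finally show "boundary H (Suc n) (chain_map G H \<rho> (Suc n) f) y = chain_map G H \<rho> n (boundary G (Suc n) f) y" .
qed

lemma chain_map_in_cycles:
  assumes "z \<in> cycles G n"
  shows "chain_map G H \<rho> n z \<in> cycles H n"
proof (cases n)
  case 0
  then show ?thesis using assms chain_map_in_chains by (simp add: cycles_def)
next
  case (Suc m)
  then have z: "z \<in> chains G (Suc m)" "boundary G (Suc m) z = (\<lambda>_. 0)" using assms by (auto simp: cycles_def)
  have "chain_map G H \<rho> m (\<lambda>_. 0) = (\<lambda>_. 0 :: 'c)" by (simp add: chain_map_def pushforward_zero)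
  then show ?thesis
    using z boundary_chain_map[OF z(1)] chain_map_in_chains[OF z(1)] Suc by (simp add: cycles_def)
qed

lemma chain_map_in_boundaries:
  assumes "b \<in> boundaries G n"
  shows "chain_map G H \<rho> n b \<in> boundaries H n"
proof -
  obtain c where "c \<in> chains G (Suc n)" "b = boundary G (Suc n) c"
    using assms by (auto simp: boundaries_def)
  then show ?thesis
    unfolding boundaries_def using boundary_chain_map chain_map_in_chains by (metis image_eqI)
qed

end

lemma chain_map_compose:
  assumes G: "etale_groupoid G" and H: "etale_groupoid H" and K: "etale_groupoid K"
    and \<rho>: "etale_hom G H \<rho>" and \<sigma>: "etale_hom H K \<sigma>" and f: "f \<in> chains G n"
  shows "chain_map G K (\<sigma> \<circ> \<rho>) n f = chain_map H K \<sigma> n (chain_map G H \<rho> n f)"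
proof -
  have "string_map (\<sigma> \<circ> \<rho>) n = string_map \<sigma> n \<circ> string_map \<rho> n"
    by (auto simp: string_map_def fun_eq_iff)
  then show ?thesis
    unfolding chain_map_def
    using pushforward_compose[OF string_map_local_homeomorphism[OF G H \<rho>]
        string_map_local_homeomorphism[OF H K \<sigma>] _ _ f[unfolded chains_def]]
      Hausdorff_strings_top etale_groupoidD(3)[OF H] etale_groupoidD(3)[OF K]
    by metis
qed

lemma chain_map_id:
  assumes G: "etale_groupoid G" and f: "f \<in> chains G n"
  shows "chain_map G G id n f = f"
proof -
  have "string_map id n x = x" if "x \<in> strings G n" for x :: "nat \<Rightarrow> 'a"
    using strings_undefined[OF that] by (auto simp: string_map_def fun_eq_iff not_less)
  then have "chain_map G G id n f = pushforward (strings_top G n) (strings_top G n) (\<lambda>x. x) f"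
    unfolding chain_map_def using topspace_strings_top[OF etale_groupoidD(2)[OF G]]
    by (intro pushforward_cong) simp
  then show ?thesis using f pushforward_identity by (simp add: chains_def)
qed

section \<open>The chain homotopy of a similarity\<close>

context groupoid_similarity
begin

text \<open>The homotopy formula says that the boundary of the prism chain plus the prism chain of
  the boundary is the difference of the two chain maps. On a cycle the second term vanishes, so the
  difference is the boundary of \<open>w\<close>.\<close>

lemma chain_homotopy:
  assumes z: "z \<in> cycles G n"
  shows "(\<lambda>y. chain_map G H \<rho> n z y - chain_map G H \<sigma> n z y) \<in> boundaries H n"
proof -
  let ?X = "strings_top G n" and ?Y = "strings_top H (Suc n)" and ?Z = "strings_top H n"
  let ?k = "\<lambda>j. prism G \<rho> \<sigma> \<theta> n j"
  have zc: "z \<in> Cc ?X" using z by (auto simp: cycles_def chains_def split: if_splits)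
  have top: "topspace ?X = strings G n" by (rule topspace_strings_top[OF GD(2)])
  have HX: "Hausdorff_space (strings_top G m)" and HY: "Hausdorff_space (strings_top H m)" for m
    using Hausdorff_strings_top GD(3) HD(3) by auto
  have face: "local_homeomorphism ?Y ?Z (face H (Suc n) i)" if "i \<le> Suc n" for i
    using face_local_homeomorphism[OF H _ that] by simp
  define w where "w = (\<lambda>y. \<Sum>j\<le>n. alternate j (pushforward ?X ?Y (?k j) z y))"
  have w: "w \<in> chains H (Suc n)"
    unfolding w_def chains_def
    by (intro Cc_sum Cc_alternate pushforward_Cc prism_local_homeomorphism HX HY zc) simp
  have "boundary H (Suc n) w y = chain_map G H \<rho> n z y - chain_map G H \<sigma> n z y" for y
  proof -
    define a where "a i j = pushforward ?X ?Z (face H (Suc n) i \<circ> ?k j) z y" for i j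
    \<comment> \<open>The truncated \<open>n - 1\<close> is harmless: in degree 0 the index range of
      \<open>b\<close> below is empty.\<close>
    define b where "b j i = pushforward ?X ?Z (prism G \<rho> \<sigma> \<theta> (n - 1) j \<circ> face G n i) z y" for i j
    have "boundary H (Suc n) w y = (\<Sum>i\<le>Suc n. alternate i (\<Sum>j\<le>n. alternate j (a i j)))"
      unfolding boundary_eq diff_Suc_1 w_def a_def
    proof (intro sum.cong refl arg_cong[where f = "alternate _"])
      fix i assume i: "i \<in> {..Suc n}"
      show "pushforward ?Y ?Z (face H (Suc n) i) (\<lambda>y. \<Sum>j\<le>n. alternate j (pushforward ?X ?Y (?k j) z y)) y =
        (\<Sum>j\<le>n. alternate j (pushforward ?X ?Z (face H (Suc n) i \<circ> ?k j) z y))"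
        by (rule pushforward_alternating_sum[where e = "\<lambda>j. j"])
          (use i in \<open>auto intro: face prism_local_homeomorphism HX HY zc\<close>)
    qed
    then have 1: "boundary H (Suc n) w y = (\<Sum>i\<le>Suc n. \<Sum>j\<le>n. alternate (i + j) (a i j))"
      by (simp add: alternate_sum alternate_simps)
    \<comment> \<open>This double sum is the prism operator of degree \<open>n - 1\<close> applied
      to the boundary of \<open>z\<close>, which is zero.\<close>
    have 2: "(\<Sum>j<n. \<Sum>i\<le>n. alternate (i + j) (b j i)) = 0"
    proof (rule sum.neutral, intro ballI)
      fix j assume "j \<in> {..<n}"
      then obtain m where n: "n = Suc m" and j: "j \<le> m" by (cases n) auto
      have lh: "local_homeomorphism (strings_top G m) ?Z (prism G \<rho> \<sigma> \<theta> m j)"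
        using prism_local_homeomorphism[OF j] n by simp
      have "(\<Sum>i\<le>n. alternate i (b j i)) = pushforward (strings_top G m) ?Z (prism G \<rho> \<sigma> \<theta> m j) (boundary G n z) y"
        unfolding b_def boundary_eq n diff_Suc_1
        by (rule pushforward_alternating_sum[symmetric, where e = "\<lambda>i. i"])
          (use lh zc n face_local_homeomorphism[OF G, of n] in \<open>auto intro: HX HY\<close>)
      also have "boundary G n z = (\<lambda>_. 0)" using z n by (simp add: cycles_def)
      finally have "(\<Sum>i\<le>n. alternate i (b j i)) = 0" by (simp add: pushforward_zero)
      then have "alternate j (\<Sum>i\<le>n. alternate i (b j i)) = 0" by (simp add: alternate_simps)
      then show "(\<Sum>i\<le>n. alternate (i + j) (b j i)) = 0"
        by (simp add: alternate_sum alternate_simps add.commute)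
    qed
    have "a i j = b (j - 1) i" if "i < j" "j \<le> n" for i j
      unfolding a_def b_def using face_prism_below[OF _ that] top
      by (intro fun_cong[OF pushforward_cong]) simp
    moreover have "a j j = a j (j - 1)" if "0 < j" "j \<le> n" for j
      unfolding a_def using face_prism_middle[OF _ that] top
      by (intro fun_cong[OF pushforward_cong]) simp
    moreover have "a i j = b j (i - 1)" if "Suc j < i" "i \<le> Suc n" for i j
      unfolding a_def b_def using face_prism_above[OF _ that] top
      by (intro fun_cong[OF pushforward_cong]) simp
    ultimately have "(\<Sum>i\<le>Suc n. \<Sum>j\<le>n. alternate (i + j) (a i j)) + (\<Sum>j<n. \<Sum>i\<le>n. alternate (i + j) (b j i))
        = a 0 0 - a (Suc n) n"
      by (rule prism_sum)
    moreover have "a 0 0 = chain_map G H \<rho> n z y"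
      unfolding a_def chain_map_def using face_prism_first top
      by (intro fun_cong[OF pushforward_cong]) simp
    moreover have "a (Suc n) n = chain_map G H \<sigma> n z y"
      unfolding a_def chain_map_def using face_prism_last top
      by (intro fun_cong[OF pushforward_cong]) simp
    ultimately show ?thesis using 1 2 by simp
  qed
  then have "(\<lambda>y. chain_map G H \<rho> n z y - chain_map G H \<sigma> n z y) = boundary H (Suc n) w" by auto
  then show ?thesis using w by (simp add: boundaries_def)
qed

end

section \<open>Invariance of homology under homological similarity\<close>

lemma similar_homs_chain_homotopy:
  assumes "etale_groupoid G" "etale_groupoid H" "etale_hom G H \<rho>" "etale_hom G H \<sigma>"
    "similar_homs G H \<rho> \<sigma>" "z \<in> cycles G n"
  shows "(\<lambda>y. chain_map G H \<rho> n z y - chain_map G H \<sigma> n z y) \<in> boundaries H n"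
proof -
  obtain \<theta> where "groupoid_similarity G H \<rho> \<sigma> \<theta>"
    using assms unfolding similar_homs_def groupoid_similarity_def by blast
  then show ?thesis using groupoid_similarity.chain_homotopy assms(6) by blast
qed

text \<open>Functoriality turns the composite chain map into that of
  \<open>\<sigma> \<circ> \<rho>\<close>, which is homotopic to the identity. Being one-sided, the
  lemma is applied a second time with the groupoids exchanged.\<close>

lemma homologically_similar_inverse:
  assumes G: "etale_groupoid G" and H: "etale_groupoid H"
    and \<rho>: "etale_hom G H \<rho>" and \<sigma>: "etale_hom H G \<sigma>" and sim: "similar_homs G G (\<sigma> \<circ> \<rho>) id"
    and z: "z \<in> cycles G n"
  shows "(\<lambda>x. chain_map H G \<sigma> n (chain_map G H \<rho> n z) x - z x) \<in> boundaries G n"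
proof -
  have c: "z \<in> chains G n" using z by (auto simp: cycles_def split: if_splits)
  show ?thesis
    using similar_homs_chain_homotopy[OF G G etale_hom_compose[OF \<rho> \<sigma>] etale_hom_id sim z]
    unfolding chain_map_compose[OF G H G \<rho> \<sigma> c] chain_map_id[OF G c] .
qed

text \<open>The value of \<open>\<pi>\<close> on classes is exported along with the isomorphism,
  because the order statement in degree 0 depends on it.\<close>

lemma homologically_similar_homology:
  assumes G: "etale_groupoid G" and H: "etale_groupoid H"
    and \<rho>: "etale_hom G H \<rho>" and \<sigma>: "etale_hom H G \<sigma>"
    and sim: "similar_homs G G (\<sigma> \<circ> \<rho>) id" "similar_homs H H (\<rho> \<circ> \<sigma>) id"
  obtains \<pi> where
    "\<pi> \<in> iso (homology G n :: ((nat \<Rightarrow> 'a) \<Rightarrow> 'c::topological_ab_group_add) set monoid) (homology H n)"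
    "\<And>z. z \<in> cycles G n \<Longrightarrow> \<pi> (r_coset (cycle_group G n) (boundaries G n) z) =
       r_coset (cycle_group H n) (boundaries H n) (chain_map G H \<rho> n z)"
proof -
  interpret f: etale_homomorphism G H \<rho> by unfold_locales (fact G H \<rho>)+
  interpret g: etale_homomorphism H G \<sigma> by unfold_locales (fact \<sigma>)
  have cc: "z \<in> chains K n" if "z \<in> cycles K n" for z :: "(nat \<Rightarrow> 'k) \<Rightarrow> 'c" and K
    using that by (auto simp: cycles_def split: if_splits)
  have wd: "f.cod.homology_class n (chain_map G H \<rho> n z) = f.cod.homology_class n (chain_map G H \<rho> n z')"
    if "z \<in> cycles G n" "z' \<in> cycles G n" "f.dom.homology_class n z = f.dom.homology_class n z'"
    for z z' :: "(nat \<Rightarrow> 'a) \<Rightarrow> 'c"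
    using that(3) f.chain_map_in_boundaries[of "\<lambda>x. z x - z' x" n]
    unfolding f.dom.homology_class_eq_iff f.cod.homology_class_eq_iff f.chain_map_diff[OF cc[OF that(1)] cc[OF that(2)]]
    by simp
  have wd': "f.dom.homology_class n (chain_map H G \<sigma> n w) = f.dom.homology_class n (chain_map H G \<sigma> n w')"
    if "w \<in> cycles H n" "w' \<in> cycles H n" "f.cod.homology_class n w = f.cod.homology_class n w'"
    for w w' :: "(nat \<Rightarrow> 'b) \<Rightarrow> 'c"
    using that(3) g.chain_map_in_boundaries[of "\<lambda>x. w x - w' x" n]
    unfolding f.dom.homology_class_eq_iff f.cod.homology_class_eq_iff g.chain_map_diff[OF cc[OF that(1)] cc[OF that(2)]]
    by simp
  have inv: "f.dom.homology_class n (chain_map H G \<sigma> n (chain_map G H \<rho> n z)) = f.dom.homology_class n z"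
    if "z \<in> cycles G n" for z :: "(nat \<Rightarrow> 'a) \<Rightarrow> 'c"
    using homologically_similar_inverse[OF G H \<rho> \<sigma> sim(1) that] by (simp add: f.dom.homology_class_eq_iff)
  have inv': "f.cod.homology_class n (chain_map G H \<rho> n (chain_map H G \<sigma> n w)) = f.cod.homology_class n w"
    if "w \<in> cycles H n" for w :: "(nat \<Rightarrow> 'b) \<Rightarrow> 'c"
    using homologically_similar_inverse[OF H G \<sigma> \<rho> sim(2) that] by (simp add: f.cod.homology_class_eq_iff)
  \<comment> \<open>A coset comes without a preferred cycle, so one is chosen; \<open>wd\<close>
    makes the choice irrelevant.\<close>
  define \<pi> where "\<pi> C = f.cod.homology_class n (chain_map G H \<rho> n (SOME z. z \<in> cycles G n \<and> C = f.dom.homology_class n z))"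
    for C :: "((nat \<Rightarrow> 'a) \<Rightarrow> 'c) set"
  have \<pi>: "\<pi> (f.dom.homology_class n z) = f.cod.homology_class n (chain_map G H \<rho> n z)" if z: "z \<in> cycles G n" for z
  proof -
    let ?z = "SOME z'. z' \<in> cycles G n \<and> f.dom.homology_class n z = f.dom.homology_class n z'"
    have "?z \<in> cycles G n \<and> f.dom.homology_class n z = f.dom.homology_class n ?z"
      by (rule someI[of _ z]) (simp add: z)
    then show ?thesis unfolding \<pi>_def using wd[OF _ z] by simp
  qed
  have "\<pi> \<in> iso (homology G n) (homology H n)"
  proof (rule isoI)
    show "\<pi> \<in> hom (homology G n) (homology H n)"
    proof (rule homI)
      fix C :: "((nat \<Rightarrow> 'a) \<Rightarrow> 'c) set" assume "C \<in> carrier (homology G n)"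
      then show "\<pi> C \<in> carrier (homology H n)"
        using \<pi> by (auto simp: f.dom.carrier_homology f.cod.carrier_homology
            intro!: imageI f.chain_map_in_cycles)
    next
      fix C D :: "((nat \<Rightarrow> 'a) \<Rightarrow> 'c) set" assume "C \<in> carrier (homology G n)" "D \<in> carrier (homology G n)"
      then obtain z w where zw: "z \<in> cycles G n" "C = f.dom.homology_class n z"
          "w \<in> cycles G n" "D = f.dom.homology_class n w"
        by (auto simp: f.dom.carrier_homology)
      show "\<pi> (C \<otimes>\<^bsub>homology G n\<^esub> D) = \<pi> C \<otimes>\<^bsub>homology H n\<^esub> \<pi> D"
        unfolding zw(2,4) f.dom.mult_homology \<pi>[OF zw(1)] \<pi>[OF zw(3)] f.cod.mult_homology
          \<pi>[OF f.dom.cycles_add[OF zw(1,3)]] f.chain_map_add[OF cc[OF zw(1)] cc[OF zw(3)]] ..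
    qed
    show "bij_betw \<pi> (carrier (homology G n)) (carrier (homology H n))"
      unfolding bij_betw_def
    proof
      show "inj_on \<pi> (carrier (homology G n))"
      proof (rule inj_onI)
        fix C D :: "((nat \<Rightarrow> 'a) \<Rightarrow> 'c) set" assume "C \<in> carrier (homology G n)" "D \<in> carrier (homology G n)" and eq: "\<pi> C = \<pi> D"
        then obtain z w where zw: "z \<in> cycles G n" "C = f.dom.homology_class n z"
            "w \<in> cycles G n" "D = f.dom.homology_class n w"
          by (auto simp: f.dom.carrier_homology)
        have "f.cod.homology_class n (chain_map G H \<rho> n z) = f.cod.homology_class n (chain_map G H \<rho> n w)"
          using eq zw \<pi> by simp
        \<comment> \<open>The chain map of \<open>\<sigma>\<close> carries the equal image classes
          back to the original ones.\<close>
        then show "C = D"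
          using wd'[OF f.chain_map_in_cycles f.chain_map_in_cycles, OF zw(1,3)] inv zw by simp
      qed
      show "\<pi> ` carrier (homology G n) = carrier (homology H n)"
      proof (intro equalityI subsetI)
        fix D :: "((nat \<Rightarrow> 'b) \<Rightarrow> 'c) set" assume "D \<in> \<pi> ` carrier (homology G n)"
        then show "D \<in> carrier (homology H n)"
          using \<pi> by (auto simp: f.dom.carrier_homology f.cod.carrier_homology
            intro!: imageI f.chain_map_in_cycles)
      next
        fix D :: "((nat \<Rightarrow> 'b) \<Rightarrow> 'c) set" assume "D \<in> carrier (homology H n)"
        then obtain w where w: "w \<in> cycles H n" "D = f.cod.homology_class n w"
          by (auto simp: f.cod.carrier_homology)
        have "D = \<pi> (f.dom.homology_class n (chain_map H G \<sigma> n w))"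
          using w inv' \<pi>[OF g.chain_map_in_cycles[OF w(1)]] by simp
        then show "D \<in> \<pi> ` carrier (homology G n)"
          using g.chain_map_in_cycles[OF w(1)] by (auto simp: f.dom.carrier_homology)
      qed
    qed
  qed
  then show ?thesis using that \<pi> by blast
qed

text \<open>Pushforward preserves nonnegativity in both directions. For the harder inclusion, the
  class of a nonnegative \<open>w\<close> is hit by the class of its pushforward along
  \<open>\<sigma>\<close>, again nonnegative, since returning along \<open>\<rho>\<close> changes
  \<open>w\<close> only by a boundary.\<close>

lemma homologically_similar_H0:
  assumes G: "etale_groupoid G" and H: "etale_groupoid H"
    and \<rho>: "etale_hom G H \<rho>" and \<sigma>: "etale_hom H G \<sigma>"
    and sim: "similar_homs G G (\<sigma> \<circ> \<rho>) id" "similar_homs H H (\<rho> \<circ> \<sigma>) id"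
  shows "\<exists>\<pi>. \<pi> \<in> iso (H0 G) (H0 H) \<and> \<pi> ` H0_pos G = H0_pos H"
proof -
  interpret f: etale_homomorphism G H \<rho> by unfold_locales (fact G H \<rho>)+
  interpret g: etale_homomorphism H G \<sigma> by unfold_locales (fact \<sigma>)
  obtain \<pi> where iso: "\<pi> \<in> iso (H0 G) (H0 H)"
    and \<pi>: "\<And>z. z \<in> cycles G 0 \<Longrightarrow> \<pi> (f.dom.homology_class 0 z) = f.cod.homology_class 0 (chain_map G H \<rho> 0 z)"
    using homologically_similar_homology[OF assms, of 0] unfolding H0_def by metis
  have nonneg: "chain_map G' H' \<tau> 0 z x \<ge> 0" if "\<And>x. z x \<ge> 0"
    for G' :: "'x groupoid" and H' :: "'y groupoid" and \<tau> and z :: "(nat \<Rightarrow> 'x) \<Rightarrow> int" and x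
    unfolding chain_map_def using that by (rule pushforward_nonneg)
  have "\<pi> ` H0_pos G = H0_pos H"
  proof (intro equalityI subsetI)
    fix D assume "D \<in> \<pi> ` H0_pos G"
    then obtain z where z: "z \<in> cycles G 0" "\<And>x. z x \<ge> 0" "D = \<pi> (f.dom.homology_class 0 z)"
      by (auto simp: H0_pos_def)
    then show "D \<in> H0_pos H"
      unfolding H0_pos_def using \<pi>[OF z(1)] f.chain_map_in_cycles[OF z(1)] nonneg[of z] by blast
  next
    fix D assume "D \<in> H0_pos H"
    then obtain w where w: "w \<in> cycles H 0" "\<And>x. w x \<ge> 0" "D = f.cod.homology_class 0 w"
      by (auto simp: H0_pos_def)
    let ?z = "chain_map H G \<sigma> 0 w"
    have z: "?z \<in> cycles G 0" using g.chain_map_in_cycles[OF w(1)] .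
    have "\<pi> (f.dom.homology_class 0 ?z) = D"
      using \<pi>[OF z] homologically_similar_inverse[OF H G \<sigma> \<rho> sim(2) w(1)] w(3)
      by (simp add: f.cod.homology_class_eq_iff)
    moreover have "f.dom.homology_class 0 ?z \<in> H0_pos G"
      unfolding H0_pos_def using z nonneg[of w] w(2) by blast
    ultimately show "D \<in> \<pi> ` H0_pos G" by blast
  qed
  then show ?thesis using iso by blast
qed

subsection \<open>Kakutani equivalence\<close>

text \<open>Connected sets have at most one point, so none meets both \<open>x\<close> and the
  complement of \<open>V\<close>. In a compact Hausdorff space two closed sets that no connected set
  joins are separated by a clopen set.\<close>

lemma clopen_neighbourhood:
  assumes X: "compact_space X" "Hausdorff_space X" "totally_disconnected_space X"
    and V: "openin X V" "x \<in> V"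
  obtains C where "openin X C" "closedin X C" "x \<in> C" "C \<subseteq> V"
proof -
  have x: "x \<in> topspace X" using V openin_subset by blast
  have "separated_between X {x} (topspace X - V)"
  proof (rule cut_wire_fence_theorem[OF X(1,2)])
    show "closedin X {x}" using closedin_Hausdorff_singleton[OF X(2) x] .
    show "closedin X (topspace X - V)" using V by blast
    fix C assume "connectedin X C"
    then obtain a where "C \<subseteq> {a}" using X(3) unfolding totally_disconnected_space_def by blast
    then show "disjnt C {x} \<or> disjnt C (topspace X - V)" using V(2) by (auto simp: disjnt_iff)
  qed
  then obtain C where "closedin X C" "openin X C" "{x} \<subseteq> C" "topspace X - V \<subseteq> topspace X - C"
    unfolding separated_between by blast
  moreover then have "C \<subseteq> V" using openin_subset[of X C] by blast
  ultimately show ?thesis using that by blast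
qed

lemma clopen_section_exists:
  assumes G: "etale_groupoid G" and X: "compact_space (unit_top G)" "totally_disconnected_space (unit_top G)"
    and Y: "openin (unit_top G) Y" and full: "full_set G Y"
  obtains \<theta> where "continuous_map (unit_top G) (gtop G) \<theta>"
    "\<And>x. x \<in> units G \<Longrightarrow> \<theta> x \<in> garr G \<and> grng G (\<theta> x) = x \<and> gsrc G (\<theta> x) \<in> Y"
proof -
  note D = etale_groupoidD[OF G]
  let ?X = "unit_top G"
  have top: "topspace ?X = units G" by (rule topspace_unit_top[OF D(2)])
  have Haus: "Hausdorff_space ?X" unfolding unit_top_def by (rule Hausdorff_space_subtopology[OF D(3)])
  define sec where "sec C t \<longleftrightarrow> continuous_map (subtopology ?X C) (gtop G) t \<and>
     (\<forall>x\<in>C. t x \<in> garr G \<and> grng G (t x) = x \<and> gsrc G (t x) \<in> Y)" for C and t :: "'a \<Rightarrow> 'a"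
  have "\<exists>C t. openin ?X C \<and> closedin ?X C \<and> x \<in> C \<and> sec C t" if x: "x \<in> units G" for x
  proof -
    obtain g where g: "g \<in> garr G" "grng G g = x" "gsrc G g \<in> Y"
      using full x by (auto simp: full_set_def)
    have lh: "local_homeomorphism (gtop G) ?X (grng G)" using G by (simp add: etale_groupoid_def)
    obtain U where U: "openin (gtop G) U" "g \<in> U" "inj_on (grng G) U"
      using local_homeomorphism_locally_injective[OF lh, of g] g D(2) by auto
    have YG: "openin (gtop G) Y"
      using Y openin_units[OF G] unfolding unit_top_def by (blast intro: openin_trans_full)
    \<comment> \<open>Restricting to arrows with source in \<open>Y\<close> keeps the values of the
      local inverse where they are wanted; the restricted set is open because \<open>Y\<close>
      is.\<close>
    let ?W = "U \<inter> {h \<in> topspace (gtop G). gsrc G h \<in> Y}"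
    have W: "openin (gtop G) ?W"
      using U(1) openin_continuous_map_preimage[OF continuous_gsrc[OF G] YG] by blast
    have inj: "inj_on (grng G) ?W" using U(3) by (rule inj_on_subset) blast
    have oV: "openin ?X (grng G ` ?W)"
      using local_homeomorphism_open_map[OF lh] W by (simp add: open_map_def)
    have xV: "x \<in> grng G ` ?W" using g U(2) D(2) by blast
    obtain C where C: "openin ?X C" "closedin ?X C" "x \<in> C" "C \<subseteq> grng G ` ?W"
      using clopen_neighbourhood[OF X(1) Haus X(2) oV xV] by blast
    have "continuous_map (subtopology ?X C) (gtop G) (inv_into ?W (grng G))"
      using continuous_map_from_subtopology_mono[OF local_homeomorphism_section[OF lh W inj] C(4)] .
    moreover have "inv_into ?W (grng G) y \<in> ?W \<and> grng G (inv_into ?W (grng G) y) = y" if "y \<in> C" for y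
      using that C(4) inv_into_into[of y "grng G" ?W] f_inv_into_f[of y "grng G" ?W] by blast
    ultimately have "sec C (inv_into ?W (grng G))" unfolding sec_def using D(2) by auto
    then show ?thesis using C by blast
  qed
  then obtain C where C: "\<And>x. x \<in> units G \<Longrightarrow> openin ?X (C x) \<and> closedin ?X (C x) \<and> x \<in> C x \<and> (\<exists>t. sec (C x) t)"
    by metis
  have "\<exists>F. finite F \<and> F \<subseteq> C ` units G \<and> topspace ?X \<subseteq> \<Union>F"
    by (rule compactinD[OF X(1)[unfolded compact_space_def]]) (use C top in blast)+
  then obtain F where F: "finite F" "F \<subseteq> C ` units G" "units G \<subseteq> \<Union>F" using top by metis
  have "openin ?X (\<Union>F) \<and> closedin ?X (\<Union>F) \<and> (\<exists>t. sec (\<Union>F) t)"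
    using F(1,2)
  proof (induction F rule: finite_induct)
    case empty
    show ?case by (simp add: sec_def)
  next
    case (insert A F)
    then obtain t where D: "openin ?X (\<Union>F)" "closedin ?X (\<Union>F)" "sec (\<Union>F) t" by auto
    obtain u where A: "openin ?X A" "closedin ?X A" "sec A u" using insert.prems C by blast
    let ?v = "\<lambda>x. if x \<in> A then u x else t x"
    \<comment> \<open>The pieces of the cover may overlap, so the new piece \<open>A\<close> takes
      precedence and the old section is kept on \<open>\<Union>F - A\<close>, which is open because
      \<open>A\<close> is closed.\<close>
    let ?T = "\<lambda>b. if b then A else \<Union>F - A"
    have "continuous_map (subtopology ?X (A \<union> \<Union>F)) (gtop G) ?v"
    proof (rule pasting_lemma[where I = UNIV and T = ?T and f = "\<lambda>b. if b then u else t"])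
      have o: "openin ?X (?T b)" for b using A D by auto
      show "openin (subtopology ?X (A \<union> \<Union>F)) (?T b)" for b
        using openin_open_subtopology[OF openin_Un[OF A(1) D(1)]] o[of b] by auto
      have u: "continuous_map (subtopology ?X A) (gtop G) u" and "continuous_map (subtopology ?X (\<Union>F)) (gtop G) t"
        using A(3) D(3) by (auto simp: sec_def)
      then have t: "continuous_map (subtopology ?X (\<Union>F - A)) (gtop G) t"
        using continuous_map_from_subtopology_mono by blast
      have "(A \<union> \<Union>F) \<inter> A = A" "(A \<union> \<Union>F) \<inter> (\<Union>F - A) = \<Union>F - A" by auto
      then show "continuous_map (subtopology (subtopology ?X (A \<union> \<Union>F)) (?T b)) (gtop G) (if b then u else t)" for b
        using u t by (cases b) (simp_all add: subtopology_subtopology)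
    qed auto
    then have "sec (A \<union> \<Union>F) ?v" using A(3) D(3) by (auto simp: sec_def)
    then show ?case using A D by (auto intro: exI[of _ ?v])
  qed
  then obtain t where t: "sec (\<Union>F) t" and "openin ?X (\<Union>F)" by blast
  then have "\<Union>F = units G" using F(3) top openin_subset by blast
  then have "subtopology ?X (\<Union>F) = ?X" using top by (metis subtopology_topspace)
  then show ?thesis using that[of t] t \<open>\<Union>F = units G\<close> by (auto simp: sec_def)
qed

section \<open>Retraction onto the reduction to a full set of units\<close>

lemma reduction_simps:
  "garr (reduction G Y) = {g \<in> garr G. grng G g \<in> Y \<and> gsrc G g \<in> Y}"
  "gsrc (reduction G Y) = gsrc G" "grng (reduction G Y) = grng G" "gmul (reduction G Y) = gmul G"
  "ginv (reduction G Y) = ginv G"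
  "gtop (reduction G Y) = subtopology (gtop G) (garr (reduction G Y))"
  by (simp_all add: reduction_def)

lemma groupoid_axioms_reduction:
  assumes G: "groupoid_axioms G"
  shows "groupoid_axioms (reduction G Y)"
  unfolding groupoid_axioms_def composable_def
  using groupoid_arrow[OF G] groupoid_mult[OF G] groupoid_assoc[OF G]
  by (simp add: reduction_simps)

locale full_section =
  fixes G :: "'a groupoid" and Y :: "'a set" and \<theta> :: "'a \<Rightarrow> 'a"
  assumes G: "etale_groupoid G" and Y: "openin (unit_top G) Y"
    and \<theta>: "continuous_map (unit_top G) (gtop G) \<theta>"
    and \<theta>_section: "\<And>x. x \<in> units G \<Longrightarrow> \<theta> x \<in> garr G \<and> grng G (\<theta> x) = x \<and> gsrc G (\<theta> x) \<in> Y"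
begin

lemmas GD = etale_groupoidD[OF G]

definition retract :: "'a \<Rightarrow> 'a" where
  "retract g = gmul G (ginv G (\<theta> (grng G g))) (gmul G g (\<theta> (gsrc G g)))"

abbreviation "R \<equiv> reduction G Y"

lemma R: "groupoid_axioms R"
  by (rule groupoid_axioms_reduction[OF GD(1)])

lemma TG: "topological_groupoid G"
  using G by (simp add: etale_groupoid_def)

text \<open>The last identity is the naturality square of \<open>\<theta>\<close>. By left
  cancellation it determines \<open>retract g\<close>, and later arguments use it in place of the
  explicit formula with an inverse.\<close>

lemma retract:
  assumes g: "g \<in> garr G"
  shows "retract g \<in> garr G" "grng G (retract g) = gsrc G (\<theta> (grng G g))"
    "gsrc G (retract g) = gsrc G (\<theta> (gsrc G g))" "retract g \<in> garr R"
    "gmul G (\<theta> (grng G g)) (retract g) = gmul G g (\<theta> (gsrc G g))"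
proof -
  have u: "grng G g \<in> units G" "gsrc G g \<in> units G" using src_rng_in_units[OF GD(1) g] by auto
  note r = \<theta>_section[OF u(1)] and s = \<theta>_section[OF u(2)]
  note ri = groupoid_arrow[OF GD(1), of "\<theta> (grng G g)"]
  have m: "gmul G g (\<theta> (gsrc G g)) \<in> garr G" "gsrc G (gmul G g (\<theta> (gsrc G g))) = gsrc G (\<theta> (gsrc G g))"
    "grng G (gmul G g (\<theta> (gsrc G g))) = grng G g"
    using groupoid_mult[OF GD(1) g, of "\<theta> (gsrc G g)"] s by auto
  show 1: "retract g \<in> garr G" "grng G (retract g) = gsrc G (\<theta> (grng G g))"
    "gsrc G (retract g) = gsrc G (\<theta> (gsrc G g))"
    unfolding retract_def
    using groupoid_mult[OF GD(1) _ m(1), of "ginv G (\<theta> (grng G g))"] ri r m by auto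
  show "retract g \<in> garr R" using 1 r s by (simp add: reduction_simps)
  show "gmul G (\<theta> (grng G g)) (retract g) = gmul G g (\<theta> (gsrc G g))"
    unfolding retract_def
    using groupoid_assoc[OF GD(1) _ _ m(1), of "\<theta> (grng G g)" "ginv G (\<theta> (grng G g))"] ri r m
      groupoid_arrow(7)[OF GD(1) m(1)] by simp
qed

text \<open>Multiply both sides on the left by \<open>\<theta> (grng G g)\<close>, move
  \<open>\<theta>\<close> to the right through both factors by two naturality squares, and
  cancel.\<close>

lemma retract_mult:
  assumes g: "g \<in> garr G" and h: "h \<in> garr G" and gh: "gsrc G g = grng G h"
  shows "retract (gmul G g h) = gmul G (retract g) (retract h)"
proof -
  note m = groupoid_mult[OF GD(1) g h gh]
  note rg = retract[OF g] and rh = retract[OF h] and rm = retract[OF m(1)]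
  have c: "gsrc G (retract g) = grng G (retract h)" using rg rh gh by simp
  note mm = groupoid_mult[OF GD(1) rg(1) rh(1) c]
  have a: "\<theta> (grng G g) \<in> garr G" using \<theta>_section src_rng_in_units(2)[OF GD(1) g] by blast
  have b: "\<theta> (gsrc G h) \<in> garr G" "grng G (\<theta> (gsrc G h)) = gsrc G h"
    using \<theta>_section src_rng_in_units(1)[OF GD(1) h] by auto
  have b': "\<theta> (grng G h) \<in> garr G" "grng G (\<theta> (grng G h)) = grng G h"
    using \<theta>_section src_rng_in_units(2)[OF GD(1) h] by auto
  have "gmul G (\<theta> (grng G g)) (gmul G (retract g) (retract h)) =
     gmul G (gmul G (\<theta> (grng G g)) (retract g)) (retract h)"
    using groupoid_assoc[OF GD(1) a rg(1) rh(1) _ c] rg by simp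
  also have "\<dots> = gmul G (gmul G g (\<theta> (grng G h))) (retract h)" using rg gh by simp
  also have "\<dots> = gmul G g (gmul G (\<theta> (grng G h)) (retract h))"
    using groupoid_assoc[OF GD(1) g b'(1) rh(1)] b' gh rh by simp
  also have "\<dots> = gmul G g (gmul G h (\<theta> (gsrc G h)))" using rh by simp
  also have "\<dots> = gmul G (gmul G g h) (\<theta> (gsrc G h))"
    using groupoid_assoc[OF GD(1) g h b(1) gh] b by simp
  also have "\<dots> = gmul G (\<theta> (grng G g)) (retract (gmul G g h))" using rm m by simp
  finally have eq: "gmul G (\<theta> (grng G g)) (gmul G (retract g) (retract h)) =
      gmul G (\<theta> (grng G g)) (retract (gmul G g h))" .
  have "gmul G (retract g) (retract h) = retract (gmul G g h)"
  proof (rule groupoid_left_cancel[OF GD(1) a mm(1) rm(1) _ _ eq])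
    show "gsrc G (\<theta> (grng G g)) = grng G (gmul G (retract g) (retract h))" unfolding mm(3) rg(2) ..
    show "gsrc G (\<theta> (grng G g)) = grng G (retract (gmul G g h))" unfolding rm(2) m(3) ..
  qed
  then show ?thesis ..
qed

lemma continuous_\<theta>_vertex:
  assumes v: "continuous_map (gtop G) (gtop G) v" "\<And>g. g \<in> garr G \<Longrightarrow> v g \<in> units G"
  shows "continuous_map (gtop G) (gtop G) (\<theta> \<circ> v)"
proof -
  have "continuous_map (gtop G) (unit_top G) v"
    using v GD(2) by (auto simp: unit_top_def continuous_map_in_subtopology)
  then show ?thesis using \<theta> by (rule continuous_map_compose)
qed

lemma continuous_retract: "continuous_map (gtop G) (gtop G) retract"
proof -
  note u = src_rng_in_units[OF GD(1)]
  have r: "continuous_map (gtop G) (gtop G) (\<theta> \<circ> grng G)" "continuous_map (gtop G) (gtop G) (\<theta> \<circ> gsrc G)"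
    using continuous_\<theta>_vertex continuous_grng[OF G] continuous_gsrc[OF G] u by auto
  have "continuous_map (gtop G) (gtop G) (\<lambda>g. gmul G g (\<theta> (gsrc G g)))"
    using r(2) \<theta>_section[OF u(1)] GD(2) by (intro continuous_gmul[OF TG]) (auto simp: o_def)
  moreover have "continuous_map (gtop G) (gtop G) (\<lambda>g. ginv G (\<theta> (grng G g)))"
    using continuous_map_compose[OF r(1) GD(4)] by (simp add: o_def)
  moreover have "gsrc G (ginv G (\<theta> (grng G g))) = grng G (gmul G g (\<theta> (gsrc G g)))" if "g \<in> garr G" for g
    using that \<theta>_section[OF u(1)[OF that]] \<theta>_section[OF u(2)[OF that]]
      groupoid_mult(3)[OF GD(1) that, of "\<theta> (gsrc G g)"] groupoid_arrow(10)[OF GD(1), of "\<theta> (grng G g)"] by simp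
  ultimately show ?thesis
    unfolding retract_def[abs_def] using GD(2) by - (rule continuous_gmul[OF TG], auto)
qed

text \<open>Two cancellations. The range map undoes \<open>\<theta>\<close>, so
  \<open>\<theta> \<circ> gsrc G\<close> is a local homeomorphism because the source map is. The
  source of \<open>retract g\<close> is the source of \<open>\<theta> (gsrc G g)\<close>, so
  cancelling the source map yields the claim.\<close>

lemma retract_local_homeomorphism: "local_homeomorphism (gtop G) (gtop G) retract"
proof (rule local_homeomorphism_cancel[OF continuous_retract gsrc_local_homeomorphism[OF G]])
  note u = src_rng_in_units[OF GD(1)]
  have "local_homeomorphism (gtop G) (gtop G) (\<theta> \<circ> gsrc G)"
  proof (rule local_homeomorphism_cancel[OF _ grng_local_homeomorphism[OF G]])
    show "continuous_map (gtop G) (gtop G) (\<theta> \<circ> gsrc G)"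
      using continuous_\<theta>_vertex[OF continuous_gsrc[OF G]] u by blast
    show "local_homeomorphism (gtop G) (gtop G) (grng G \<circ> (\<theta> \<circ> gsrc G))"
      using gsrc_local_homeomorphism[OF G]
      by (rule local_homeomorphism_cong) (use \<theta>_section[OF u(1)] GD(2) in auto)
  qed
  from local_homeomorphism_compose[OF this gsrc_local_homeomorphism[OF G]]
  show "local_homeomorphism (gtop G) (gtop G) (gsrc G \<circ> retract)"
    by (rule local_homeomorphism_cong) (use retract GD(2) in auto)
qed

text \<open>It is through openness of \<open>Y\<close> that the inclusion of the reduction becomes
  etale.\<close>

lemma openin_R: "openin (gtop G) (garr R)"
proof -
  have "openin (gtop G) Y"
    using Y openin_units[OF G] unfolding unit_top_def by (blast intro: openin_trans_full)
  then have "openin (gtop G) ({g \<in> topspace (gtop G). grng G g \<in> Y} \<inter> {g \<in> topspace (gtop G). gsrc G g \<in> Y})"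
    using continuous_grng[OF G] continuous_gsrc[OF G] by (blast intro: openin_continuous_map_preimage)
  moreover have "{g \<in> topspace (gtop G). grng G g \<in> Y} \<inter> {g \<in> topspace (gtop G). gsrc G g \<in> Y} = garr R"
    using GD(2) by (auto simp: reduction_simps)
  ultimately show ?thesis by simp
qed

lemma topspace_R: "topspace (gtop R) = garr R"
  using GD(2) by (auto simp: reduction_simps)

lemma etale_hom_retract: "etale_hom G R retract"
proof -
  have "local_homeomorphism (gtop G) (gtop R) retract"
    unfolding reduction_simps(6)
    by (rule local_homeomorphism_into_subtopology[OF retract_local_homeomorphism]) (simp add: GD(2) retract)
  then show ?thesis
    unfolding etale_hom_def groupoid_hom_def composable_def
    using local_homeomorphism_continuous retract retract_mult
    by (simp add: reduction_simps(2-4))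
qed

lemma etale_hom_inclusion: "etale_hom R G (\<lambda>x. x)"
  unfolding etale_hom_def groupoid_hom_def composable_def
  using local_homeomorphism_inclusion[OF openin_R] local_homeomorphism_continuous[OF local_homeomorphism_inclusion[OF openin_R]]
  by (auto simp: reduction_simps)

end

text \<open>The isomorphism and its inverse enter symmetrically, so a second interpretation with the
  groupoids exchanged gives the other homomorphism and the other similarity.\<close>

locale kakutani_equivalence = A: full_section G1 Y1 \<theta>1 + B: full_section G2 Y2 \<theta>2
  for G1 :: "'a groupoid" and Y1 \<theta>1 and G2 :: "'b groupoid" and Y2 \<theta>2 +
  fixes f :: "'a \<Rightarrow> 'b" and f' :: "'b \<Rightarrow> 'a"
  assumes f: "groupoid_hom A.R B.R f" and f': "groupoid_hom B.R A.R f'"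
    and f'f: "\<And>g. g \<in> garr A.R \<Longrightarrow> f' (f g) = g" and ff': "\<And>h. h \<in> garr B.R \<Longrightarrow> f (f' h) = h"
begin

lemma etale_hom_transfer: "etale_hom G1 G2 (f \<circ> A.retract)"
proof -
  have "homeomorphic_maps (gtop A.R) (gtop B.R) f f'"
    using f f' f'f ff' A.topspace_R B.topspace_R by (auto simp: homeomorphic_maps_def groupoid_hom_def)
  then have e: "etale_hom A.R B.R f"
    using f homeomorphic_map_imp_local_homeomorphism homeomorphic_maps_map unfolding etale_hom_def by blast
  show ?thesis
    using etale_hom_compose[OF etale_hom_compose[OF A.etale_hom_retract e] B.etale_hom_inclusion]
    by (simp add: o_def)
qed

text \<open>Two natural transformations are composed: \<open>\<theta>1\<close>, from the first
  retraction to the identity, and \<open>\<phi>\<close>, the transport of \<open>\<theta>2\<close>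
  through the isomorphism of reductions. Thus \<open>\<Theta> x\<close> is an arrow into
  \<open>x\<close> that factors through a unit of \<open>Y1\<close>.\<close>

lemma similar_transfer_id: "similar_homs G1 G1 ((f' \<circ> B.retract) \<circ> (f \<circ> A.retract)) id"
proof -
  note fD = groupoid_homD[OF A.R B.R f, unfolded reduction_simps(2,3)]
  note f'D = groupoid_homD[OF B.R A.R f', unfolded reduction_simps(2,3)]
  note u1 = src_rng_in_units[OF A.GD(1)]
  \<comment> \<open>\<open>y x\<close> is the unit of \<open>Y1\<close> to which the first
    retraction sends \<open>x\<close>.\<close>
  define y where "y x = gsrc G1 (\<theta>1 x)" for x
  have y: "y x \<in> garr A.R" "y x \<in> units G1" if "x \<in> units G1" for x
  proof -
    show u: "y x \<in> units G1" using A.\<theta>_section[OF that] u1 by (auto simp: y_def)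
    have "y x \<in> Y1" using A.\<theta>_section[OF that] by (simp add: y_def)
    then show "y x \<in> garr A.R" using unitsD[OF A.GD(1) u] by (simp add: reduction_simps)
  qed
  have fy: "f (y x) \<in> units G2" "f (y x) \<in> Y2" if "x \<in> units G1" for x
  proof -
    have "f (y x) \<in> garr B.R" "gsrc G2 (f (y x)) = f (y x)"
      using fD[OF y(1)[OF that]] unitsD[OF A.GD(1) y(2)[OF that]] by auto
    then show "f (y x) \<in> units G2" "f (y x) \<in> Y2" by (auto simp: reduction_simps units_def)
  qed
  \<comment> \<open>Range and source of this arrow both lie in \<open>Y2\<close>, so it belongs to
    the reduction and \<open>f'\<close> may be applied to it.\<close>
  have t2: "\<theta>2 (f (y x)) \<in> garr B.R" "grng G2 (\<theta>2 (f (y x))) = f (y x)" if "x \<in> units G1" for x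
    using B.\<theta>_section[OF fy(1)[OF that]] fy(2)[OF that] by (auto simp: reduction_simps)
  define \<phi> where "\<phi> x = f' (\<theta>2 (f (y x)))" for x
  have \<phi>: "\<phi> x \<in> garr A.R" "\<phi> x \<in> garr G1" "grng G1 (\<phi> x) = y x" if "x \<in> units G1" for x
  proof -
    show 1: "\<phi> x \<in> garr A.R" unfolding \<phi>_def using f'D(1)[OF t2(1)[OF that]] .
    then show "\<phi> x \<in> garr G1" by (simp add: reduction_simps)
    show "grng G1 (\<phi> x) = y x"
      unfolding \<phi>_def using f'D(3)[OF t2(1)[OF that]] t2(2)[OF that] f'f[OF y(1)[OF that]] by simp
  qed
  define \<Theta> where "\<Theta> x = gmul G1 (\<theta>1 x) (\<phi> x)" for x
  have \<Theta>: "\<Theta> x \<in> garr G1" "grng G1 (\<Theta> x) = x" "gsrc G1 (\<Theta> x) = gsrc G1 (\<phi> x)" if "x \<in> units G1" for x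
    using groupoid_mult[OF A.GD(1) _ \<phi>(2)[OF that], of "\<theta>1 x"] A.\<theta>_section[OF that] \<phi>[OF that]
    by (auto simp: \<Theta>_def y_def)
  have "continuous_map (unit_top G1) (gtop G1) \<Theta>"
  proof -
    have top: "topspace (unit_top G1) = units G1" by (rule topspace_unit_top[OF A.GD(2)])
    have "continuous_map (unit_top G1) (gtop G1) y"
      using continuous_map_compose[OF A.\<theta> continuous_gsrc[OF A.G]] by (simp add: y_def[abs_def] o_def)
    then have "continuous_map (unit_top G1) (gtop A.R) y"
      using y(1) top by (auto simp: reduction_simps(6) continuous_map_in_subtopology)
    then have "continuous_map (unit_top G1) (gtop B.R) (f \<circ> y)"
      using f by (auto simp: groupoid_hom_def intro: continuous_map_compose)
    then have "continuous_map (unit_top G1) (unit_top G2) (f \<circ> y)"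
      using fy(1) top by (auto simp: reduction_simps(6) unit_top_def continuous_map_in_subtopology)
    then have "continuous_map (unit_top G1) (gtop G2) (\<theta>2 \<circ> (f \<circ> y))"
      using B.\<theta> by (rule continuous_map_compose)
    then have "continuous_map (unit_top G1) (gtop B.R) (\<theta>2 \<circ> (f \<circ> y))"
      using t2(1) top by (auto simp: reduction_simps(6) continuous_map_in_subtopology)
    then have "continuous_map (unit_top G1) (gtop A.R) (f' \<circ> (\<theta>2 \<circ> (f \<circ> y)))"
      using f' by (auto simp: groupoid_hom_def intro: continuous_map_compose)
    then have "continuous_map (unit_top G1) (gtop G1) \<phi>"
      by (simp add: reduction_simps(6) continuous_map_in_subtopology \<phi>_def[abs_def] o_def)
    then show ?thesis
      unfolding \<Theta>_def[abs_def] using top \<phi>(3)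
      by (intro continuous_gmul[OF A.TG A.\<theta>]) (auto simp: y_def)
  qed
  moreover have "composable G1 (\<Theta> (grng G1 g)) (f' (B.retract (f (A.retract g)))) \<and>
      composable G1 g (\<Theta> (gsrc G1 g)) \<and>
      gmul G1 (\<Theta> (grng G1 g)) (f' (B.retract (f (A.retract g)))) = gmul G1 g (\<Theta> (gsrc G1 g))"
    if g: "g \<in> garr G1" for g
  proof -
    define k where "k = f (A.retract g)"
    define l where "l = f' (B.retract k)"
    note ug = u1[OF g] and rg = A.retract[OF g]
    have k: "k \<in> garr B.R" "k \<in> garr G2" "grng G2 k = f (y (grng G1 g))" "gsrc G2 k = f (y (gsrc G1 g))"
      using fD[OF rg(4)] rg by (auto simp: k_def y_def reduction_simps)
    note rk = B.retract[OF k(2)]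
    have l: "l \<in> garr A.R" "l \<in> garr G1" "grng G1 l = f' (grng G2 (B.retract k))"
      using f'D[OF rk(4)] by (auto simp: l_def reduction_simps)
    have \<phi>s: "gsrc G1 (\<phi> (grng G1 g)) = grng G1 l"
      using f'D(2)[OF t2(1)[OF ug(2)]] l rk k by (simp add: \<phi>_def)
    \<comment> \<open>Naturality of \<open>\<phi>\<close>: apply \<open>f'\<close> to the naturality
      square of the second retraction at \<open>k\<close>.\<close>
    have "gmul G1 (\<phi> (grng G1 g)) l = f' (gmul G2 (\<theta>2 (grng G2 k)) (B.retract k))"
      using groupoid_hom_mult[OF f' _ rk(4), of "\<theta>2 (grng G2 k)"] t2[OF ug(2)] k rk
      by (simp add: \<phi>_def l_def reduction_simps(2-4))
    also have "\<dots> = f' (gmul G2 k (\<theta>2 (gsrc G2 k)))" using rk by simp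
    also have "\<dots> = gmul G1 (f' k) (\<phi> (gsrc G1 g))"
      using groupoid_hom_mult[OF f' k(1), of "\<theta>2 (gsrc G2 k)"] t2[OF ug(1)] k
      by (simp add: \<phi>_def reduction_simps(2-4))
    also have "f' k = A.retract g" unfolding k_def using f'f[OF rg(4)] .
    finally have eq: "gmul G1 (\<phi> (grng G1 g)) l = gmul G1 (A.retract g) (\<phi> (gsrc G1 g))" .
    note r = A.\<theta>_section[OF ug(2)] and s = A.\<theta>_section[OF ug(1)]
    have "gmul G1 (\<Theta> (grng G1 g)) l = gmul G1 (\<theta>1 (grng G1 g)) (gmul G1 (\<phi> (grng G1 g)) l)"
      unfolding \<Theta>_def
      using groupoid_assoc[OF A.GD(1) _ \<phi>(2)[OF ug(2)] l(2), of "\<theta>1 (grng G1 g)"] r \<phi>(3)[OF ug(2)] \<phi>s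
      by (simp add: y_def)
    also have "\<dots> = gmul G1 (gmul G1 (\<theta>1 (grng G1 g)) (A.retract g)) (\<phi> (gsrc G1 g))"
      unfolding eq using groupoid_assoc[OF A.GD(1) _ rg(1) \<phi>(2)[OF ug(1)], of "\<theta>1 (grng G1 g)"] r rg \<phi>(3)[OF ug(1)]
      by (simp add: y_def)
    also have "\<dots> = gmul G1 (gmul G1 g (\<theta>1 (gsrc G1 g))) (\<phi> (gsrc G1 g))" using rg by simp
    also have "\<dots> = gmul G1 g (\<Theta> (gsrc G1 g))"
      unfolding \<Theta>_def
      using groupoid_assoc[OF A.GD(1) g _ \<phi>(2)[OF ug(1)], of "\<theta>1 (gsrc G1 g)"] s \<phi>(3)[OF ug(1)]
      by (simp add: y_def)
    finally show ?thesis
      using \<Theta>[OF ug(1)] \<Theta>[OF ug(2)] \<phi>s g l(2) by (simp add: composable_def l_def k_def)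
  qed
  ultimately show ?thesis unfolding similar_homs_def by auto
qed

end

lemma kakutani_equivalent_similarity:
  assumes G1: "etale_groupoid G1" "compact_space (unit_top G1)" "totally_disconnected_space (unit_top G1)"
    and G2: "etale_groupoid G2" "compact_space (unit_top G2)" "totally_disconnected_space (unit_top G2)"
    and K: "kakutani_equivalent G1 G2"
  obtains \<rho> \<sigma> where "etale_hom G1 G2 \<rho>" "etale_hom G2 G1 \<sigma>"
    "similar_homs G1 G1 (\<sigma> \<circ> \<rho>) id" "similar_homs G2 G2 (\<rho> \<circ> \<sigma>) id"
proof -
  obtain Y1 Y2 f f' where Y: "openin (unit_top G1) Y1" "openin (unit_top G2) Y2" "full_set G1 Y1" "full_set G2 Y2"
    and f: "groupoid_hom (reduction G1 Y1) (reduction G2 Y2) f" "groupoid_hom (reduction G2 Y2) (reduction G1 Y1) f'"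
      "\<forall>g \<in> garr (reduction G1 Y1). f' (f g) = g" "\<forall>h \<in> garr (reduction G2 Y2). f (f' h) = h"
    using K unfolding kakutani_equivalent_def groupoid_iso_def by blast
  obtain \<theta>1 where t1: "full_section G1 Y1 \<theta>1"
    using clopen_section_exists[OF G1 Y(1,3)] G1(1) Y(1) unfolding full_section_def by metis
  obtain \<theta>2 where t2: "full_section G2 Y2 \<theta>2"
    using clopen_section_exists[OF G2 Y(2,4)] G2(1) Y(2) unfolding full_section_def by metis
  interpret A: kakutani_equivalence G1 Y1 \<theta>1 G2 Y2 \<theta>2 f f'
    using t1 t2 f by (simp add: kakutani_equivalence_def kakutani_equivalence_axioms_def)
  interpret B: kakutani_equivalence G2 Y2 \<theta>2 G1 Y1 \<theta>1 f' f
    using t1 t2 f by (simp add: kakutani_equivalence_def kakutani_equivalence_axioms_def)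
  show ?thesis
    using that[OF A.etale_hom_transfer B.etale_hom_transfer A.similar_transfer_id B.similar_transfer_id] .
qed

theorem theorem4p8:
  fixes G1 :: "'a groupoid" and G2 :: "'b groupoid"
  assumes "etale_groupoid G1" and "compact_space (unit_top G1)"
    and "totally_disconnected_space (unit_top G1)"
    and "etale_groupoid G2" and "compact_space (unit_top G2)"
    and "totally_disconnected_space (unit_top G2)"
    and "kakutani_equivalent G1 G2"
  shows "homologically_similar G1 G2 \<and>
    (\<forall>n. (homology G1 n :: ((nat \<Rightarrow> 'a) \<Rightarrow> 'c::topological_ab_group_add) set monoid)
           \<cong> (homology G2 n :: ((nat \<Rightarrow> 'b) \<Rightarrow> 'c) set monoid)) \<and>
    (\<exists>\<pi>. \<pi> \<in> iso (H0 G1) (H0 G2) \<and> \<pi> ` H0_pos G1 = H0_pos G2)"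
proof -
  obtain \<rho> \<sigma> where sim: "etale_hom G1 G2 \<rho>" "etale_hom G2 G1 \<sigma>"
    "similar_homs G1 G1 (\<sigma> \<circ> \<rho>) id" "similar_homs G2 G2 (\<rho> \<circ> \<sigma>) id"
    using kakutani_equivalent_similarity[OF assms] by blast
  have "(homology G1 n :: ((nat \<Rightarrow> 'a) \<Rightarrow> 'c) set monoid) \<cong> (homology G2 n :: ((nat \<Rightarrow> 'b) \<Rightarrow> 'c) set monoid)" for n
    by (rule homologically_similar_homology[OF assms(1,4) sim, of n]) (auto simp: is_iso_def)
  then show ?thesis
    using sim homologically_similar_H0[OF assms(1,4) sim] unfolding homologically_similar_def by blast
qed

end
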